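(* The blow-up $Bl_0(\mathbb{H}^n)$ of $\mathbb{H}^n$ at $0$ is a quaternionic regular manifold of real dimension $4n$. Moreover, the exceptional set $\{0\}\times\mathbb{HP}^{n-1}$ is a quaternionic submanifold of $Bl_0(\mathbb{H}^n)$ of real dimension $4n-4$.
   Context: **Slice regularity.** $\mathbb{H}$ is the skew field of quaternions and $\mathbb{S}=\{J\in\mathbb{H}: J^2=-1\}$. Let $D\subseteq\mathbb{C}^n$ be open and invariant under complex conjugation in each variable separately, and let $\Omega_D=\{(q_1,\dots,q_n)\in\mathbb{H}^n: q_h=x_h+y_hJ_h,\ x_h,y_h\in\mathbb{R},\ J_h\in\mathbb{S},\ (x_1+y_1i,\dots,x_n+y_ni)\in D\}$. A $C^1$ stem function on $D$ is a family $F=(F_K)_{K\subseteq\{1,\dots,n\}}$ of $C^1$ functions $F_K:D\to\mathbb{H}$ such that conjugating the variable $z_h$ leaves $F_K$ unchanged if $h\notin K$ and changes $F_K$ to $-F_K$ if $h\in K$. It is holomorphic if for every $h$ and every $K\not\ni h$ one has $\partial F_K/\partial x_h=\partial F_{K\cup\{h\}}/\partial y_h$ and $\partial F_K/\partial y_h=-\partial F_{K\cup\{h\}}/\partial x_h$ on $D$, where $z_h=x_h+iy_h$. A function $f:\Omega_D\to\mathbb{H}$ is left slice regular if for some holomorphic stem function $F$ one has $f(x_1+y_1J_1,\dots,x_n+y_nJ_n)=\sum_K J_{k_1}J_{k_2}\cdots J_{k_s}\,F_K(x_1+y_1i,\dots,x_n+y_ni)$, where $K=\{k_1<\dots<k_s\}$;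 it is right slice regular if for some holomorphic stem function $F$ one has $f(x_1+y_1J_1,\dots,x_n+y_nJ_n)=\sum_K F_K(x_1+y_1i,\dots,x_n+y_ni)\,J_{k_s}\cdots J_{k_2}J_{k_1}$ (for example $q_1q_2$ is left slice regular and $q_2q_1$ is right slice regular). A differentiable map $\Omega_D\to\mathbb{H}^m$ is slice regular if each of its components is either left or right slice regular. **Quaternionic regular manifolds.** A differentiable manifold of real dimension $4n$ is quaternionic regular if it admits a differentiable atlas $\{(U_i,\varphi_i)\}$, $\varphi_i:U_i\to\mathbb{H}^n$ (a regular atlas), all of whose transition functions $\varphi_j\circ\varphi_i^{-1}:\varphi_i(U_i\cap U_j)\to\varphi_j(U_i\cap U_j)$ are slice regular. A subset $S$ of a quaternionic regular manifold of real dimension $4n$ is a quaternionic submanifold of real dimension $4n-4$ if it is covered by charts $(V,\varphi)$ of the regular atlas such that $\varphi(S\cap V)$ is the part of $\varphi(V)$ lying in a coordinate hyperplane $\{b_i=0\}\subset\mathbb{H}^n$, the restricted charts forming a regular atlas of $S$. **Blow-up.** $\mathbb{HP}^{n-1}$ is the set of right vector lines $[a_1,\dots,a_n]=\{(a_1\lambda,\dots,a_n\lambda):\lambda\in\mathbb{H}\}$ of $\mathbb{H}^n$, with its usual topology. $Bl_0(\mathbb{H}^n)=\Gamma_\varphi\cup(\{0\}\times\mathbb{HP}^{n-1})\subset\mathbb{H}^n\times\mathbb{HP}^{n-1}$ with the induced topology, where $\Gamma_\varphi=\{(q,[a])\in(\mathbb{H}^n\setminus\{0\})\times\mathbb{HP}^{n-1}: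 q\in[a]\}$ is the graph of the projection $\mathbb{H}^n\setminus\{0\}\to\mathbb{HP}^{n-1}$. The subset $\{0\}\times\mathbb{HP}^{n-1}$ is the exceptional set. *)

theory Defs
  imports "HOL-Analysis.Analysis"
begin

section \<open>Quaternions\<close>

codatatype quat = Quat (qRe: real) (qI: real) (qJ: real) (qK: real)

lemma quat_eqI:
  "qRe x = qRe y \<Longrightarrow> qI x = qI y \<Longrightarrow> qJ x = qJ y \<Longrightarrow> qK x = qK y \<Longrightarrow> x = y"
  by (rule quat.expand) simp

lemma quat_eq_iff:
  "x = y \<longleftrightarrow> qRe x = qRe y \<and> qI x = qI y \<and> qJ x = qJ y \<and> qK x = qK y"
  by (auto intro: quat_eqI)

instantiation quat :: ab_group_add
begin

primcorec zero_quat where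
  "qRe 0 = 0" | "qI 0 = 0" | "qJ 0 = 0" | "qK 0 = 0"

primcorec plus_quat where
  "qRe (x + y) = qRe x + qRe y"
| "qI (x + y) = qI x + qI y"
| "qJ (x + y) = qJ x + qJ y"
| "qK (x + y) = qK x + qK y"

primcorec uminus_quat where
  "qRe (- x) = - qRe x"
| "qI (- x) = - qI x"
| "qJ (- x) = - qJ x"
| "qK (- x) = - qK x"

primcorec minus_quat where
  "qRe (x - y) = qRe x - qRe y"
| "qI (x - y) = qI x - qI y"
| "qJ (x - y) = qJ x - qJ y"
| "qK (x - y) = qK x - qK y"

instance
  by standard (simp_all add: quat_eq_iff)

end

definition qnorm2 :: "quat \<Rightarrow> real" where
  "qnorm2 x = (qRe x)\<^sup>2 + (qI x)\<^sup>2 + (qJ x)\<^sup>2 + (qK x)\<^sup>2"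

lemma qnorm2_nonneg [simp]: "0 \<le> qnorm2 x"
  by (simp add: qnorm2_def)

lemma qnorm2_eq_0_iff [simp]: "qnorm2 x = 0 \<longleftrightarrow> x = 0"
  by (simp add: qnorm2_def quat_eq_iff add_nonneg_eq_0_iff)

instantiation quat :: division_ring
begin

primcorec one_quat where
  "qRe 1 = 1" | "qI 1 = 0" | "qJ 1 = 0" | "qK 1 = 0"

primcorec times_quat where
  "qRe (x * y) = qRe x * qRe y - qI x * qI y - qJ x * qJ y - qK x * qK y"
| "qI (x * y) = qRe x * qI y + qI x * qRe y + qJ x * qK y - qK x * qJ y"
| "qJ (x * y) = qRe x * qJ y - qI x * qK y + qJ x * qRe y + qK x * qI y"
| "qK (x * y) = qRe x * qK y + qI x * qJ y - qJ x * qI y + qK x * qRe y"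

primcorec inverse_quat where
  "qRe (inverse x) = qRe x / qnorm2 x"
| "qI (inverse x) = - qI x / qnorm2 x"
| "qJ (inverse x) = - qJ x / qnorm2 x"
| "qK (inverse x) = - qK x / qnorm2 x"

definition "x div y = x * inverse y" for x y :: quat

instance
proof
  fix x y z :: quat
  show "x * y * z = x * (y * z)"
    by (simp add: quat_eq_iff algebra_simps)
  show "1 * x = x" "x * 1 = x" "(0::quat) \<noteq> 1"
    by (simp_all add: quat_eq_iff)
  show "(x + y) * z = x * z + y * z" "x * (y + z) = x * y + x * z"
    by (simp_all add: quat_eq_iff algebra_simps)
  show "x div y = x * inverse y"
    by (simp add: divide_quat_def)
  show "inverse (0::quat) = 0"
    by (simp add: quat_eq_iff)
  assume "x \<noteq> 0"
  then have "qnorm2 x \<noteq> 0" by simp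
  then show "inverse x * x = 1" "x * inverse x = 1"
    by (simp_all add: quat_eq_iff add_divide_distrib [symmetric] diff_divide_distrib [symmetric])
       (simp_all add: qnorm2_def power2_eq_square algebra_simps)
qed

end

instantiation quat :: real_algebra_1
begin

primcorec scaleR_quat where
  "qRe (scaleR r x) = r * qRe x"
| "qI (scaleR r x) = r * qI x"
| "qJ (scaleR r x) = r * qJ x"
| "qK (scaleR r x) = r * qK x"

instance
  by standard (simp_all add: quat_eq_iff algebra_simps)

end

instance quat :: real_div_algebra ..

instantiation quat :: real_inner
begin

definition inner_quat :: "quat \<Rightarrow> quat \<Rightarrow> real" where
  "inner x y = qRe x * qRe y + qI x * qI y + qJ x * qJ y + qK x * qK y"

definition norm_quat :: "quat \<Rightarrow> real" where
  "norm x = sqrt (qnorm2 x)" for x :: quat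

definition sgn_quat :: "quat \<Rightarrow> quat" where
  "sgn x = x /\<^sub>R norm x" for x :: quat

definition dist_quat :: "quat \<Rightarrow> quat \<Rightarrow> real" where
  "dist x y = norm (x - y)" for x y :: quat

definition uniformity_quat :: "(quat \<times> quat) filter" where
  "(uniformity :: (quat \<times> quat) filter) = (INF e\<in>{0 <..}. principal {(x, y). dist x y < e})"

definition open_quat :: "quat set \<Rightarrow> bool" where
  "open U \<longleftrightarrow> (\<forall>x\<in>U. eventually (\<lambda>(x', y). x' = x \<longrightarrow> y \<in> U) uniformity)" for U :: "quat set"

instance
proof
  fix x y z :: quat and r :: real and U :: "quat set"
  have eq: "inner x x = qnorm2 x" for x :: quat
    by (simp add: inner_quat_def qnorm2_def power2_eq_square)
  show "inner x y = inner y x" "inner (x + y) z = inner x z + inner y z"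
    "inner (scaleR r x) y = r * inner x y"
    by (simp_all add: inner_quat_def algebra_simps)
  show "0 \<le> inner x x" "(inner x x = 0) = (x = 0)" "norm x = sqrt (inner x x)"
    by (simp_all add: eq norm_quat_def)
  show "sgn x = x /\<^sub>R norm x" "dist x y = norm (x - y)"
    by (simp_all add: sgn_quat_def dist_quat_def)
  show "uniformity = (INF e\<in>{0 <..}. principal {(x::quat, y). dist x y < e})"
    by (rule uniformity_quat_def)
  show "open U = (\<forall>x\<in>U. eventually (\<lambda>(x', y). x' = x \<longrightarrow> y \<in> U) uniformity)"
    by (rule open_quat_def)
qed

end

instance quat :: real_normed_div_algebra
proof
  fix x y :: quat
  have "qnorm2 (x * y) = qnorm2 x * qnorm2 y"
    by (simp add: qnorm2_def power2_eq_square algebra_simps)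
  then show "norm (x * y) = norm x * norm y"
    by (simp add: norm_quat_def real_sqrt_mult)
qed

instantiation quat :: euclidean_space
begin

definition Basis_quat :: "quat set" where
  "Basis_quat = {Quat 1 0 0 0, Quat 0 1 0 0, Quat 0 0 1 0, Quat 0 0 0 1}"

instance
proof
  show "(Basis :: quat set) \<noteq> {}" "finite (Basis :: quat set)"
    by (simp_all add: Basis_quat_def)
  fix u v x :: quat
  show "inner u v = (if u = v then 1 else 0)" if "u \<in> Basis" "v \<in> Basis"
    using that unfolding Basis_quat_def by (elim insertE emptyE) (simp_all add: inner_quat_def)
  show "(\<forall>u\<in>Basis. inner x u = 0) \<longleftrightarrow> x = 0"
    unfolding Basis_quat_def ball_simps quat_eq_iff [of x] by (simp add: inner_quat_def)
qed

end


section \<open>Coordinate subspaces and differentiability classes\<close>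

text \<open>
  For a set \<open>I\<close> of indices, the space of families \<open>(v\<^sub>h)\<close> with \<open>h\<close> in \<open>I\<close> is realised inside the
  space of all families as \<open>coord_space I\<close>.  In this way \<open>\<bbbH>\<^sup>m\<close> and \<open>\<complex>\<^sup>m\<close>, with \<open>m = card I\<close> and the
  coordinates numbered in increasing order, are available for all \<open>m \<le> CARD('n)\<close> (including
  \<open>m = 0\<close>); in particular a coordinate hyperplane \<open>b\<^sub>i = 0\<close> of \<open>\<bbbH>\<^sup>n\<close> is \<open>coord_space (- {i})\<close>.
\<close>

definition coord_space :: "'n set \<Rightarrow> ('a::zero ^ 'n) set" where
  "coord_space I = {v. \<forall>h. h \<notin> I \<longrightarrow> v $ h = 0}"

text \<open>
  \<open>f\<close> is of class \<open>C\<^sup>k\<close> on \<open>S\<close>, where \<open>S\<close> is a relatively open subset of the linear space \<open>V\<close>: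
  the derivative at a point of \<open>S\<close> is then uniquely determined on \<open>V\<close>, and it is required to be
  of class \<open>C\<^sup>k\<^sup>-\<^sup>1\<close> in every direction of \<open>V\<close>.
\<close>

primrec Ck_on :: "nat \<Rightarrow> 'a set \<Rightarrow> 'a set \<Rightarrow>
    ('a::real_normed_vector \<Rightarrow> 'b::real_normed_vector) \<Rightarrow> bool" where
  "Ck_on 0 V S f \<longleftrightarrow> continuous_on S f"
| "Ck_on (Suc k) V S f \<longleftrightarrow>
    (\<exists>f'. (\<forall>x\<in>S. (f has_derivative f' x) (at x within S)) \<and>
          (\<forall>v\<in>V. Ck_on k V S (\<lambda>x. f' x v)))"

definition smooth_on :: "'a set \<Rightarrow> 'a set \<Rightarrow>
    ('a::real_normed_vector \<Rightarrow> 'b::real_normed_vector) \<Rightarrow> bool" where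
  "smooth_on V S f \<longleftrightarrow> (\<forall>k. Ck_on k V S f)"


section \<open>Slice regularity\<close>

definition imag_units :: "quat set" where
  "imag_units = {J. J * J = - 1}"

definition conj_var :: "'n \<Rightarrow> complex ^ 'n \<Rightarrow> complex ^ 'n" where
  "conj_var h z = (\<chi> k. if k = h then cnj (z $ k) else z $ k)"

definition cpoint :: "real ^ 'n \<Rightarrow> real ^ 'n \<Rightarrow> complex ^ 'n" where
  "cpoint x y = (\<chi> h. Complex (x $ h) (y $ h))"

definition qpoint :: "real ^ 'n \<Rightarrow> real ^ 'n \<Rightarrow> quat ^ 'n \<Rightarrow> quat ^ 'n" where
  "qpoint x y J = (\<chi> h. of_real (x $ h) + of_real (y $ h) * J $ h)"

definition stem_domain :: "'n::finite set \<Rightarrow> (complex ^ 'n) set \<Rightarrow> bool" where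
  "stem_domain I D \<longleftrightarrow> openin (top_of_set (coord_space I)) D \<and>
     (\<forall>h\<in>I. \<forall>z\<in>D. conj_var h z \<in> D)"

text \<open>If \<open>D\<close> is a subset of \<open>coord_space I\<close>, so is \<open>circularization D\<close>.\<close>

definition circularization :: "(complex ^ 'n) set \<Rightarrow> (quat ^ 'n) set" where
  "circularization D =
     {qpoint x y J | x y J. (\<forall>h. J $ h \<in> imag_units) \<and> cpoint x y \<in> D}"

definition dx :: "'n::finite \<Rightarrow> (complex ^ 'n \<Rightarrow> quat) \<Rightarrow> complex ^ 'n \<Rightarrow> quat" where
  "dx h f z = vector_derivative (\<lambda>t::real. f (z + t *\<^sub>R axis h 1)) (at 0)"

definition dy :: "'n::finite \<Rightarrow> (complex ^ 'n \<Rightarrow> quat) \<Rightarrow> complex ^ 'n \<Rightarrow> quat" where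
  "dy h f z = vector_derivative (\<lambda>t::real. f (z + t *\<^sub>R axis h \<i>)) (at 0)"

definition C1_stem :: "'n::finite set \<Rightarrow> (complex ^ 'n) set \<Rightarrow>
    ('n set \<Rightarrow> complex ^ 'n \<Rightarrow> quat) \<Rightarrow> bool" where
  "C1_stem I D F \<longleftrightarrow> (\<forall>K\<subseteq>I. Ck_on 1 (coord_space I) D (F K) \<and>
     (\<forall>h\<in>I. \<forall>z\<in>D. F K (conj_var h z) = (if h \<in> K then - F K z else F K z)))"

definition holomorphic_stem :: "'n::finite set \<Rightarrow> (complex ^ 'n) set \<Rightarrow>
    ('n set \<Rightarrow> complex ^ 'n \<Rightarrow> quat) \<Rightarrow> bool" where
  "holomorphic_stem I D F \<longleftrightarrow> C1_stem I D F \<and>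
     (\<forall>h\<in>I. \<forall>K\<subseteq>I. h \<notin> K \<longrightarrow> (\<forall>z\<in>D.
        dx h (F K) z = dy h (F (insert h K)) z \<and>
        dy h (F K) z = - dx h (F (insert h K)) z))"

definition unit_prod :: "quat ^ 'n::{finite,linorder} \<Rightarrow> 'n set \<Rightarrow> quat" where
  "unit_prod J K = prod_list (map (($) J) (sorted_list_of_set K))"

definition unit_prod_rev :: "quat ^ 'n::{finite,linorder} \<Rightarrow> 'n set \<Rightarrow> quat" where
  "unit_prod_rev J K = prod_list (map (($) J) (rev (sorted_list_of_set K)))"

definition left_slice_regular :: "'n set \<Rightarrow> (complex ^ 'n::{finite,linorder}) set \<Rightarrow>
    (quat ^ 'n::{finite,linorder} \<Rightarrow> quat) \<Rightarrow> bool" where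
  "left_slice_regular I D f \<longleftrightarrow> (\<exists>F. holomorphic_stem I D F \<and>
     (\<forall>x y J. (\<forall>h. J $ h \<in> imag_units) \<and> cpoint x y \<in> D \<longrightarrow>
        f (qpoint x y J) = (\<Sum>K\<in>Pow I. unit_prod J K * F K (cpoint x y))))"

definition right_slice_regular :: "'n set \<Rightarrow> (complex ^ 'n::{finite,linorder}) set \<Rightarrow>
    (quat ^ 'n::{finite,linorder} \<Rightarrow> quat) \<Rightarrow> bool" where
  "right_slice_regular I D f \<longleftrightarrow> (\<exists>F. holomorphic_stem I D F \<and>
     (\<forall>x y J. (\<forall>h. J $ h \<in> imag_units) \<and> cpoint x y \<in> D \<longrightarrow>
        f (qpoint x y J) = (\<Sum>K\<in>Pow I. F K (cpoint x y) * unit_prod_rev J K)))"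

text \<open>
  A slice regular map from \<open>U\<close>, a set in the quaternionic variables indexed by \<open>I\<close>, to the
  quaternionic space with coordinates indexed by \<open>I'\<close>.  That \<open>U\<close> is the circularization of an
  open conjugation-invariant set is part of the notion.
\<close>

definition slice_regular_map :: "'n set \<Rightarrow> 'n set \<Rightarrow> (quat ^ 'n::{finite,linorder}) set \<Rightarrow>
    (quat ^ 'n::{finite,linorder} \<Rightarrow> quat ^ 'n::{finite,linorder}) \<Rightarrow> bool" where
  "slice_regular_map I I' U f \<longleftrightarrow>
     smooth_on (coord_space I) U f \<and> f ` U \<subseteq> coord_space I' \<and>
     (\<exists>D. stem_domain I D \<and> U = circularization D \<and>
        (\<forall>k\<in>I'. left_slice_regular I D (\<lambda>q. f q $ k) \<or>
                right_slice_regular I D (\<lambda>q. f q $ k)))"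


section \<open>Quaternionic regular manifolds\<close>

text \<open>
  A chart is a triple \<open>(I, U, \<phi>)\<close>: the map \<open>\<phi>\<close> is defined on \<open>U\<close> and has values in \<open>coord_space I\<close>;
  its values outside \<open>U\<close> are irrelevant.
\<close>

type_synonym ('p, 'n) qchart = "'n set \<times> 'p set \<times> ('p \<Rightarrow> quat ^ 'n)"

definition is_qchart :: "nat \<Rightarrow> 'p topology \<Rightarrow> ('p, 'n::finite) qchart \<Rightarrow> bool" where
  "is_qchart d X c \<longleftrightarrow> (case c of (I, U, \<phi>) \<Rightarrow>
     d = 4 * card I \<and> openin X U \<and>
     openin (top_of_set (coord_space I)) (\<phi> ` U) \<and>
     homeomorphic_map (subtopology X U) (top_of_set (\<phi> ` U)) \<phi>)"

definition slice_regular_transition ::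
    "('p, 'n::{finite,linorder}) qchart \<Rightarrow> ('p, 'n::{finite,linorder}) qchart \<Rightarrow> bool" where
  "slice_regular_transition c c' \<longleftrightarrow> (case (c, c') of ((I, U, \<phi>), (I', U', \<phi>')) \<Rightarrow>
     slice_regular_map I I' (\<phi> ` (U \<inter> U')) (\<phi>' \<circ> inv_into U \<phi>))"

definition regular_atlas ::
    "nat \<Rightarrow> 'p topology \<Rightarrow> ('p, 'n::{finite,linorder}) qchart set \<Rightarrow> bool" where
  "regular_atlas d X A \<longleftrightarrow>
     (\<forall>c\<in>A. is_qchart d X c) \<and>
     (\<Union>(I, U, \<phi>)\<in>A. U) = topspace X \<and>
     (\<forall>c\<in>A. \<forall>c'\<in>A. slice_regular_transition c c')"

text \<open>\<open>X\<close> with the regular atlas \<open>A\<close> is a quaternionic regular manifold of real dimension \<open>d\<close>.\<close>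

definition quaternionic_regular_manifold ::
    "nat \<Rightarrow> 'p topology \<Rightarrow> ('p, 'n::{finite,linorder}) qchart set \<Rightarrow> bool" where
  "quaternionic_regular_manifold d X A \<longleftrightarrow>
     Hausdorff_space X \<and> second_countable X \<and> regular_atlas d X A"

text \<open>
  The set \<open>B\<close> consists of pairs of a chart of the atlas and the index \<open>i\<close> of the coordinate
  hyperplane in which the chart straightens \<open>S\<close>; dropping the coordinate \<open>i\<close> turns the
  restriction of the chart to \<open>S\<close> into a chart of \<open>S\<close>.  The charts of \<open>B\<close> cover \<open>S\<close> because
  the restricted charts form an atlas of \<open>S\<close>.
\<close>

definition quaternionic_submanifold :: "nat \<Rightarrow> 'p topology \<Rightarrow>
    ('p, 'n::{finite,linorder}) qchart set \<Rightarrow> 'p set \<Rightarrow> bool" where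
  "quaternionic_submanifold d X A S \<longleftrightarrow>
     quaternionic_regular_manifold (d + 4) X A \<and> S \<subseteq> topspace X \<and>
     (\<exists>B. (\<forall>(i, I, V, \<phi>)\<in>B. (I, V, \<phi>) \<in> A \<and> i \<in> I \<and>
              \<phi> ` (S \<inter> V) = \<phi> ` V \<inter> {b. b $ i = 0}) \<and>
          quaternionic_regular_manifold d (subtopology X S)
            {(I - {i}, S \<inter> V, \<phi>) | i I V \<phi>. (i, I, V, \<phi>) \<in> B})"


section \<open>Quaternionic projective space and the blow-up\<close>

definition qline :: "quat ^ 'n \<Rightarrow> (quat ^ 'n) set" where
  "qline a = {(\<chi> h. a $ h * l) | l. True}"

definition HP :: "(quat ^ 'n) set set" where
  "HP = qline ` (UNIV - {0})"

text \<open>The quotient topology with respect to the projection \<open>qline\<close>.\<close>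

definition HP_topology :: "(quat ^ 'n::finite) set topology" where
  "HP_topology = topology (\<lambda>W. W \<subseteq> HP \<and> open {a. a \<noteq> 0 \<and> qline a \<in> W})"

lemma istopology_HP:
  "istopology (\<lambda>W. W \<subseteq> HP \<and> open {a :: quat ^ 'n::finite. a \<noteq> 0 \<and> qline a \<in> W})"
  unfolding istopology_def
proof (intro conjI allI impI)
  fix S T :: "(quat ^ 'n) set set"
  assume S: "S \<subseteq> HP \<and> open {a. a \<noteq> 0 \<and> qline a \<in> S}"
    and T: "T \<subseteq> HP \<and> open {a. a \<noteq> 0 \<and> qline a \<in> T}"
  then show "S \<inter> T \<subseteq> HP" by blast
  have eq: "{a. a \<noteq> 0 \<and> qline a \<in> S \<inter> T} =
      {a. a \<noteq> 0 \<and> qline a \<in> S} \<inter> {a. a \<noteq> 0 \<and> qline a \<in> T}"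
    by blast
  show "open {a. a \<noteq> 0 \<and> qline a \<in> S \<inter> T}"
    unfolding eq by (intro open_Int conjunct2[OF S] conjunct2[OF T])
next
  fix \<W> :: "(quat ^ 'n) set set set"
  assume W: "\<forall>W\<in>\<W>. W \<subseteq> HP \<and> open {a. a \<noteq> 0 \<and> qline a \<in> W}"
  then show "\<Union>\<W> \<subseteq> HP" by blast
  have eq: "{a. a \<noteq> 0 \<and> qline a \<in> \<Union>\<W>} = (\<Union>W\<in>\<W>. {a. a \<noteq> 0 \<and> qline a \<in> W})"
    by blast
  show "open {a. a \<noteq> 0 \<and> qline a \<in> \<Union>\<W>}"
    unfolding eq using W by (intro open_UN) blast
qed

lemma openin_HP_topology:
  "openin HP_topology W \<longleftrightarrow> W \<subseteq> HP \<and> open {a :: quat ^ 'n::finite. a \<noteq> 0 \<and> qline a \<in> W}"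
  unfolding HP_topology_def topology_inverse'[OF istopology_HP] ..

definition exceptional_set :: "((quat ^ 'n) \<times> (quat ^ 'n) set) set" where
  "exceptional_set = {0} \<times> HP"

definition blowup :: "((quat ^ 'n) \<times> (quat ^ 'n) set) set" where
  "blowup = {(q, l). q \<noteq> 0 \<and> l \<in> HP \<and> q \<in> l} \<union> exceptional_set"

definition blowup_topology :: "((quat ^ 'n::finite) \<times> (quat ^ 'n) set) topology" where
  "blowup_topology = subtopology (prod_topology euclidean HP_topology) blowup"

end

theory Submission
  imports Defs
begin

text \<open>
  On the set where \<open>a\<^sub>i \<noteq> 0\<close> the pair \<open>(q, [a])\<close> gets the coordinates \<open>b\<^sub>h = a\<^sub>h a\<^sub>i\<inverse>\<close> for
  \<open>h \<noteq> i\<close> and \<open>b\<^sub>i = q\<^sub>i\<close>; then \<open>q\<^sub>h = b\<^sub>h b\<^sub>i\<close>, and the exceptional set is \<open>b\<^sub>i = 0\<close>.  The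
  transition to the chart \<open>j\<close> has the components \<open>b\<^sub>j b\<^sub>i\<close>, \<open>b\<^sub>j\<inverse>\<close> and \<open>b\<^sub>h b\<^sub>j\<inverse>\<close>.  Each of them
  is a Laurent monomial in at most two distinct variables, hence left slice regular if the variables
  occur in increasing order and right slice regular otherwise.  The Hausdorff property follows
  because the orthogonal projection matrix of a line is a continuous injective invariant.
\<close>

section \<open>Closure properties of \<open>C\<^sup>k\<close> functions\<close>

lemma Ck_on_cong:
  assumes "\<And>x. x \<in> S \<Longrightarrow> f x = g x"
  shows "Ck_on k V S f \<longleftrightarrow> Ck_on k V S g"
proof (cases k)
  case 0
  then show ?thesis using assms by (simp cong: continuous_on_cong)
next
  case (Suc m)
  have "(f has_derivative f' x) (at x within S) \<longleftrightarrow> (g has_derivative f' x) (at x within S)"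
    if "x \<in> S" for f' x
    using that assms by (metis has_derivative_transform)
  then show ?thesis unfolding Suc Ck_on.simps by blast
qed

text \<open>At the lowest level this is continuity of differentiable functions; above it, the same
  derivative serves and the induction hypothesis applies to each directional derivative. It lets
  factors that stay undifferentiated in the product rule drop by one class.\<close>

lemma Ck_on_SucD: "Ck_on (Suc k) V S f \<Longrightarrow> Ck_on k V S f"
proof (induction k arbitrary: f)
  case 0
  then show ?case
    by (auto simp: continuous_on_eq_continuous_within intro: has_derivative_continuous)
next
  case (Suc k)
  from Suc.prems obtain f' where "\<forall>x\<in>S. (f has_derivative f' x) (at x within S)"
    "\<forall>v\<in>V. Ck_on (Suc k) V S (\<lambda>x. f' x v)"
    unfolding Ck_on.simps(2)[of "Suc k"] by blast
  with Suc.IH show ?case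
    unfolding Ck_on.simps(2)[of k] by blast
qed

lemma Ck_on_const: "Ck_on k V S (\<lambda>x. c)"
proof (induction k arbitrary: c)
  case (Suc k)
  show ?case unfolding Ck_on.simps
    by (intro exI[of _ "\<lambda>_ _. 0"]) (simp add: Suc)
qed simp

lemma Ck_on_linear_compose:
  assumes "bounded_linear L" "Ck_on k V S f"
  shows "Ck_on k V S (\<lambda>x. L (f x))"
  using assms(2)
proof (induction k arbitrary: f)
  case 0
  then show ?case using bounded_linear.continuous_on[OF assms(1)] by auto
next
  case (Suc k)
  then obtain f' where f': "\<forall>x\<in>S. (f has_derivative f' x) (at x within S)"
    "\<forall>v\<in>V. Ck_on k V S (\<lambda>x. f' x v)" by auto
  show ?case unfolding Ck_on.simps
    by (intro exI[of _ "\<lambda>x v. L (f' x v)"])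
      (use f' Suc.IH bounded_linear.has_derivative[OF assms(1)] in blast)
qed

lemma Ck_on_bounded_linear:
  assumes "bounded_linear L"
  shows "Ck_on k V S L"
proof (cases k)
  case 0
  then show ?thesis using linear_continuous_on[OF assms] by simp
next
  case (Suc m)
  show ?thesis unfolding Suc Ck_on.simps
    by (intro exI[of _ "\<lambda>_. L"])
      (simp add: Ck_on_const bounded_linear_imp_has_derivative[OF assms])
qed

lemma Ck_on_add:
  assumes "Ck_on k V S f" "Ck_on k V S g"
  shows "Ck_on k V S (\<lambda>x. f x + g x)"
  using assms
proof (induction k arbitrary: f g)
  case (Suc k)
  then obtain f' g' where
    "\<forall>x\<in>S. (f has_derivative f' x) (at x within S)" "\<forall>v\<in>V. Ck_on k V S (\<lambda>x. f' x v)"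
    "\<forall>x\<in>S. (g has_derivative g' x) (at x within S)" "\<forall>v\<in>V. Ck_on k V S (\<lambda>x. g' x v)"
    by auto
  then show ?case unfolding Ck_on.simps
    by (intro exI[of _ "\<lambda>x v. f' x v + g' x v"]) (auto intro: Suc.IH has_derivative_add)
qed (auto intro: continuous_intros)

text \<open>Both factors vary in the induction, because the product rule yields
  \<open>f * g'\<close> and \<open>f' * g\<close>, whose factors are of class \<open>k\<close>.
  Their order is kept, since quaternions do not commute.\<close>

lemma Ck_on_mult:
  fixes f g :: "'a::real_normed_vector \<Rightarrow> 'b::real_normed_algebra"
  assumes "Ck_on k V S f" "Ck_on k V S g"
  shows "Ck_on k V S (\<lambda>x. f x * g x)"
  using assms
proof (induction k arbitrary: f g)
  case (Suc k)
  have fg: "Ck_on k V S f" "Ck_on k V S g" using Suc.prems Ck_on_SucD by blast+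
  from Suc obtain f' g' where
    f': "\<forall>x\<in>S. (f has_derivative f' x) (at x within S)" "\<forall>v\<in>V. Ck_on k V S (\<lambda>x. f' x v)" and
    g': "\<forall>x\<in>S. (g has_derivative g' x) (at x within S)" "\<forall>v\<in>V. Ck_on k V S (\<lambda>x. g' x v)"
    by auto
  have "Ck_on k V S (\<lambda>x. f x * g' x v + f' x v * g x)" if "v \<in> V" for v
    using that f' g' by (intro Ck_on_add Suc.IH fg) auto
  then show ?case unfolding Ck_on.simps
    using f' g' by (intro exI[of _ "\<lambda>x v. f x * g' x v + f' x v * g x"])
      (auto intro: has_derivative_mult)
qed (auto intro: continuous_intros)

text \<open>The derivative of \<open>inverse (f x)\<close> in direction \<open>v\<close> is
  \<open>- (inverse (f x) * f' x v * inverse (f x))\<close>. It involves only \<open>f'\<close> and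
  the inverse itself, which is of class \<open>k\<close> by the induction hypothesis for the same
  \<open>f\<close>.\<close>

lemma Ck_on_inverse:
  fixes f :: "'a::real_normed_vector \<Rightarrow> 'b::real_normed_div_algebra"
  assumes "Ck_on k V S f" "\<And>x. x \<in> S \<Longrightarrow> f x \<noteq> 0"
  shows "Ck_on k V S (\<lambda>x. inverse (f x))"
  using assms(1)
proof (induction k)
  case 0
  then show ?case using assms(2) by (auto intro: continuous_intros)
next
  case (Suc k)
  have inv: "Ck_on k V S (\<lambda>x. inverse (f x))" using Suc Ck_on_SucD by blast
  from Suc obtain f' where
    f': "\<forall>x\<in>S. (f has_derivative f' x) (at x within S)" "\<forall>v\<in>V. Ck_on k V S (\<lambda>x. f' x v)"
    by auto
  have "Ck_on k V S (\<lambda>x. - (inverse (f x) * f' x v * inverse (f x)))" if "v \<in> V" for v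
    using that f' by (intro Ck_on_linear_compose[OF bounded_linear_minus[OF bounded_linear_ident]]
        Ck_on_mult inv) auto
  moreover have "((\<lambda>x. inverse (f x)) has_derivative
      (\<lambda>v. - (inverse (f x) * f' x v * inverse (f x)))) (at x within S)" if "x \<in> S" for x
    using that f' assms(2) by (auto intro: Deriv.has_derivative_inverse)
  ultimately show ?case unfolding Ck_on.simps
    by (intro exI[of _ "\<lambda>x v. - (inverse (f x) * f' x v * inverse (f x))"]) auto
qed

lemma Ck_on_power_int:
  fixes f :: "'a::real_normed_vector \<Rightarrow> 'b::real_normed_div_algebra"
  assumes "Ck_on k V S f" "\<And>x. x \<in> S \<Longrightarrow> m < 0 \<Longrightarrow> f x \<noteq> 0"
  shows "Ck_on k V S (\<lambda>x. f x powi m)"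
proof -
  have pow: "Ck_on k V S (\<lambda>x. g x ^ n)" if "Ck_on k V S g" for g :: "'a \<Rightarrow> 'b" and n
    by (induction n) (use that in \<open>auto intro: Ck_on_const Ck_on_mult\<close>)
  show ?thesis
  proof (cases "m \<ge> 0")
    case True
    then show ?thesis using pow[OF assms(1)] by (simp add: power_int_def)
  next
    case False
    then show ?thesis using pow[OF Ck_on_inverse[OF assms(1)]] assms(2)
      by (simp add: power_int_def)
  qed
qed

lemma Ck_on_prod:
  fixes f :: "'i \<Rightarrow> 'a::real_normed_vector \<Rightarrow> 'b::real_normed_field"
  assumes "\<And>i. i \<in> I \<Longrightarrow> Ck_on k V S (f i)"
  shows "Ck_on k V S (\<lambda>x. \<Prod>i\<in>I. f i x)"
  using assms
  by (induction I rule: infinite_finite_induct) (auto intro: Ck_on_const Ck_on_mult)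

text \<open>Differentiability of a vector-valued map is tested by inner products with the basis
  vectors \<open>axis i u\<close>, and such a product sees only component \<open>i\<close>. The
  derivative is therefore assembled from those of the components.\<close>

lemma Ck_on_vec_lambda:
  fixes f :: "'i::finite \<Rightarrow> 'a::real_normed_vector \<Rightarrow> 'b::euclidean_space"
  assumes "\<And>i. Ck_on k V S (f i)"
  shows "Ck_on k V S (\<lambda>x. \<chi> i. f i x)"
  using assms
proof (induction k arbitrary: f)
  case 0
  then show ?case by (auto intro: continuous_intros)
next
  case (Suc k)
  then have "\<forall>i. \<exists>f'. (\<forall>x\<in>S. (f i has_derivative f' x) (at x within S)) \<and>
      (\<forall>v\<in>V. Ck_on k V S (\<lambda>x. f' x v))" by simp
  then obtain f' where f': "\<And>i x. x \<in> S \<Longrightarrow> (f i has_derivative f' i x) (at x within S)"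
    "\<And>i v. v \<in> V \<Longrightarrow> Ck_on k V S (\<lambda>x. f' i x v)" by metis
  show ?case unfolding Ck_on.simps
    by (intro exI[of _ "\<lambda>x v. \<chi> i. f' i x v"])
      (auto intro: Suc.IH f' simp: has_derivative_componentwise_within[of "\<lambda>x. \<chi> i. f i x"]
        Basis_vec_def inner_axis intro!: bounded_linear.has_derivative[OF bounded_linear_inner_left])
qed

section \<open>Slice regularity of Laurent monomials\<close>

text \<open>For an imaginary unit \<open>J\<close> this is the embedding of the field of complex
  numbers into the quaternions that sends the imaginary unit to \<open>J\<close>.\<close>

definition slice_embed :: "quat \<Rightarrow> complex \<Rightarrow> quat" where
  "slice_embed J z = of_real (Re z) + of_real (Im z) * J"

lemma of_real_quat_simps [simp]:
  "qRe (of_real r) = r" "qI (of_real r) = 0" "qJ (of_real r) = 0" "qK (of_real r) = 0"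
  by (simp_all add: of_real_def)

lemma slice_embed_eq_scaleR: "slice_embed J z = Re z *\<^sub>R 1 + Im z *\<^sub>R J"
  by (simp add: slice_embed_def scaleR_conv_of_real)

lemma slice_embed_1 [simp]: "slice_embed J 1 = 1"
  by (simp add: slice_embed_def)

lemma slice_embed_mult:
  assumes "J \<in> imag_units"
  shows "slice_embed J (z * w) = slice_embed J z * slice_embed J w"
  using assms
  by (simp add: imag_units_def slice_embed_eq_scaleR algebra_simps)

lemma slice_embed_power:
  assumes "J \<in> imag_units"
  shows "slice_embed J (z ^ n) = slice_embed J z ^ n"
  by (induction n) (simp_all add: slice_embed_mult[OF assms])

lemma slice_embed_eq_0_iff:
  assumes "J \<in> imag_units"
  shows "slice_embed J z = 0 \<longleftrightarrow> z = 0"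
proof
  assume "slice_embed J z = 0"
  \<comment> \<open>Multiplying by the embedded conjugate turns the argument into the real number
    \<open>(cmod z)^2\<close>, which the embedding fixes.\<close>
  then have "slice_embed J (cnj z * z) = 0" by (simp add: slice_embed_mult[OF assms])
  then have "slice_embed J (of_real ((cmod z)\<^sup>2)) = 0" by (simp add: complex_norm_square mult.commute del: of_real_power)
  then show "z = 0" by (simp add: slice_embed_def del: of_real_power)
qed (simp add: slice_embed_def)

lemma slice_embed_inverse:
  assumes "J \<in> imag_units"
  shows "slice_embed J (inverse z) = inverse (slice_embed J z)"
proof (cases "z = 0")
  case True
  then show ?thesis by (simp add: slice_embed_def)
next
  case False
  then have "slice_embed J (inverse z) * slice_embed J z = 1"
    by (simp add: slice_embed_mult[OF assms, symmetric])
  then show ?thesis by (metis inverse_unique inverse_inverse_eq nonzero_inverse_inverse_eq mult_zero_left zero_neq_one)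
qed

lemma slice_embed_power_int:
  assumes "J \<in> imag_units"
  shows "slice_embed J (z powi m) = slice_embed J z powi m"
  by (simp add: power_int_def slice_embed_power slice_embed_inverse assms)

text \<open>Dividing the vector part of \<open>q\<close> by its length \<open>y\<close> gives the
  unit \<open>J\<close>, and \<open>y\<close> becomes the imaginary part of
  \<open>z\<close>.\<close>

lemma quat_in_slice: "\<exists>J\<in>imag_units. \<exists>z. q = slice_embed J z"
proof -
  define y where "y = sqrt ((qI q)\<^sup>2 + (qJ q)\<^sup>2 + (qK q)\<^sup>2)"
  have y2: "y * y = (qI q)\<^sup>2 + (qJ q)\<^sup>2 + (qK q)\<^sup>2"
    by (simp add: y_def)
  show ?thesis
  proof (cases "y = 0")
    case True
    then have "qI q = 0" "qJ q = 0" "qK q = 0"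
      by (simp_all add: y_def add_nonneg_eq_0_iff)
    \<comment> \<open>A real quaternion lies in every slice, so an arbitrary unit is taken.\<close>
    then have "q = slice_embed (Quat 0 1 0 0) (of_real (qRe q))"
      by (simp add: slice_embed_def quat_eq_iff)
    moreover have "Quat 0 1 0 0 \<in> imag_units" by (simp add: imag_units_def quat_eq_iff)
    ultimately show ?thesis by blast
  next
    case False
    then have unit: "(qI q / y)\<^sup>2 + (qJ q / y)\<^sup>2 + (qK q / y)\<^sup>2 = 1"
      using y2 by (simp add: power_divide flip: add_divide_distrib) (simp add: power2_eq_square)
    let ?J = "Quat 0 (qI q / y) (qJ q / y) (qK q / y)"
    have "q = slice_embed ?J (Complex (qRe q) y)"
      using False by (simp add: slice_embed_def quat_eq_iff)
    moreover have "?J \<in> imag_units"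
      using unit by (simp add: imag_units_def quat_eq_iff power2_eq_square)
    ultimately show ?thesis by blast
  qed
qed

section \<open>Stem functions and slice regularity of ordered monomials\<close>

definition cpart :: "bool \<Rightarrow> complex \<Rightarrow> real" where
  "cpart b z = (if b then Im z else Re z)"

lemma bounded_linear_cpart: "bounded_linear (cpart b)"
  unfolding cpart_def by (cases b) (simp_all add: bounded_linear_Re bounded_linear_Im)

lemma cpart_cnj: "cpart b (cnj z) = (if b then - 1 else 1) * cpart b z"
  by (simp add: cpart_def)

text \<open>Distributivity without changing the order of the factors: each factor is its real part
  plus its imaginary part times \<open>J h\<close>, and \<open>K\<close> records the factors from
  which the imaginary part is taken. The coefficients are real and move to the front. In the
  induction, the subsets are split according to whether they contain the head \<open>a\<close> of
  the list.\<close>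

lemma sum_cpart_prod_list:
  assumes "distinct L"
  shows "(\<Sum>K\<in>Pow (set L). (\<Prod>h\<in>set L. cpart (h \<in> K) (w h)) *\<^sub>R
      prod_list (map J (filter (\<lambda>h. h \<in> K) L))) =
    prod_list (map (\<lambda>h. slice_embed (J h) (w h)) L)"
  using assms
proof (induction L)
  case (Cons a L)
  let ?S = "set L"
  let ?f = "\<lambda>K. (\<Prod>h\<in>?S. cpart (h \<in> K) (w h)) *\<^sub>R prod_list (map J (filter (\<lambda>h. h \<in> K) L))"
  let ?g = "\<lambda>K. (\<Prod>h\<in>set (a # L). cpart (h \<in> K) (w h)) *\<^sub>R
      prod_list (map J (filter (\<lambda>h. h \<in> K) (a # L)))"
  have a: "a \<notin> ?S" using Cons.prems by simp
  have g1: "?g K = Re (w a) *\<^sub>R ?f K" if "K \<in> Pow ?S" for K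
  proof -
    have "a \<notin> K" using that a by blast
    then show ?thesis using a by (simp add: cpart_def)
  qed
  have g2: "?g (insert a K) = Im (w a) *\<^sub>R (J a * ?f K)" if "K \<in> Pow ?S" for K
  proof -
    have "(\<Prod>h\<in>?S. cpart (h \<in> insert a K) (w h)) = (\<Prod>h\<in>?S. cpart (h \<in> K) (w h))"
      using a by (intro prod.cong refl arg_cong2[where f = cpart]) auto
    moreover have "filter (\<lambda>h. h \<in> insert a K) L = filter (\<lambda>h. h \<in> K) L"
      using a by (intro filter_cong) auto
    moreover have "cpart (a \<in> insert a K) (w a) = Im (w a)" by (simp add: cpart_def)
    ultimately show ?thesis using a by simp
  qed
  have "(\<Sum>K\<in>Pow (set (a # L)). ?g K) = (\<Sum>K\<in>Pow ?S. ?g K) + (\<Sum>K\<in>insert a ` Pow ?S. ?g K)"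
    unfolding list.set(2) Pow_insert using a by (intro sum.union_disjoint) auto
  also have "(\<Sum>K\<in>insert a ` Pow ?S. ?g K) = (\<Sum>K\<in>Pow ?S. ?g (insert a K))"
    using a by (subst sum.reindex) (auto simp: inj_on_def)
  also have "(\<Sum>K\<in>Pow ?S. ?g K) + (\<Sum>K\<in>Pow ?S. ?g (insert a K)) =
      (\<Sum>K\<in>Pow ?S. Re (w a) *\<^sub>R ?f K) + (\<Sum>K\<in>Pow ?S. Im (w a) *\<^sub>R (J a * ?f K))"
    using g1 g2 by (intro arg_cong2[where f = "(+)"] sum.cong refl) auto
  also have "\<dots> = Re (w a) *\<^sub>R (\<Sum>K\<in>Pow ?S. ?f K) + Im (w a) *\<^sub>R (J a * (\<Sum>K\<in>Pow ?S. ?f K))"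
    by (simp only: scaleR_sum_right sum_distrib_left)
  also have "\<dots> = slice_embed (J a) (w a) * prod_list (map (\<lambda>h. slice_embed (J h) (w h)) L)"
    using Cons by (simp add: slice_embed_eq_scaleR algebra_simps)
  finally show ?case by simp
qed simp

text \<open>Makes the ordered product of units over \<open>K\<close> a subword of the ordered list
  of all variables, the form in which it appears in \<open>sum_cpart_prod_list\<close>.\<close>

lemma sorted_list_of_set_subset:
  assumes "finite I" "K \<subseteq> I"
  shows "sorted_list_of_set K = filter (\<lambda>h. h \<in> K) (sorted_list_of_set I)"
proof (rule sorted_distinct_set_unique)
  have "finite K" using assms finite_subset by blast
  then show "set (sorted_list_of_set K) = set (filter (\<lambda>h. h \<in> K) (sorted_list_of_set I))"
    using assms by auto
qed (auto intro: sorted_filter[where f = id, simplified])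

lemma prod_list_filter_neutral:
  fixes f :: "'i \<Rightarrow> 'a::monoid_mult"
  assumes "\<And>h. h \<in> set L \<Longrightarrow> \<not> P h \<Longrightarrow> f h = 1"
  shows "prod_list (map f (filter P L)) = prod_list (map f L)"
  using assms by (induction L) auto

text \<open>
  Stem function of the Laurent monomial \<open>\<Prod>\<^sub>h q\<^sub>h\<^bsup>m h\<^esup>\<close>.  It does not depend on the order of the
  factors: increasing order gives a left, decreasing order a right slice regular function.
\<close>
definition monomial_stem ::
    "'n::finite set \<Rightarrow> ('n \<Rightarrow> int) \<Rightarrow> 'n set \<Rightarrow> complex ^ 'n \<Rightarrow> quat" where
  "monomial_stem I m K z = of_real (\<Prod>h\<in>I. cpart (h \<in> K) (z $ h powi m h))"

text \<open>Conjugation commutes with integer powers and affects only factor \<open>h\<close>; it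
  negates that factor exactly when its imaginary part is taken.\<close>

lemma monomial_stem_conj_var:
  assumes "h \<in> I"
  shows "monomial_stem I m K (conj_var h z) =
    (if h \<in> K then - monomial_stem I m K z else monomial_stem I m K z)"
proof -
  have "cpart (g \<in> K) (conj_var h z $ g powi m g) =
      (if g = h then if h \<in> K then - 1 else 1 else 1) * cpart (g \<in> K) (z $ g powi m g)" for g
    by (simp add: conj_var_def cpart_cnj flip: complex_cnj_power_int)
  then show ?thesis
    using assms by (simp add: monomial_stem_def prod.distrib)
qed

text \<open>Only factor \<open>h\<close> varies along the line, so the map is a real-linear function
  of the complex power \<open>w powi m h\<close>, whose derivative in direction \<open>c\<close> is
  \<open>c\<close> times its complex derivative. The directions 1 and \<open>\<i>\<close> yield
  \<open>dx\<close> and \<open>dy\<close>.\<close>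

lemma has_vector_derivative_monomial_stem:
  assumes "h \<in> I" "m h < 0 \<Longrightarrow> z $ h \<noteq> 0"
  shows "((\<lambda>t. monomial_stem I m K (z + t *\<^sub>R axis h c)) has_vector_derivative
    of_real (cpart (h \<in> K) (c * (of_int (m h) * z $ h powi (m h - 1))) *
      (\<Prod>g\<in>I - {h}. cpart (g \<in> K) (z $ g powi m g)))) (at 0)"
proof -
  let ?C = "\<Prod>g\<in>I - {h}. cpart (g \<in> K) (z $ g powi m g)"
  have eq: "monomial_stem I m K (z + t *\<^sub>R axis h c) =
      of_real (cpart (h \<in> K) ((z $ h + of_real t * c) powi m h) * ?C)" for t
  proof -
    have "(\<Prod>g\<in>I - {h}. cpart (g \<in> K) ((z + t *\<^sub>R axis h c) $ g powi m g)) = ?C"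
      by (intro prod.cong) (auto simp: axis_def)
    moreover have "(z + t *\<^sub>R axis h c) $ h = z $ h + of_real t * c"
      unfolding vector_add_component vector_scaleR_component axis_def
      by (simp add: scaleR_conv_of_real)
    ultimately show ?thesis using assms(1)
      by (simp only: monomial_stem_def prod.remove[of I h] finite)
  qed
  have lin: "((\<lambda>t. z $ h + of_real t * c) has_vector_derivative c) (at 0)"
    by (auto intro!: derivative_eq_intros simp: has_vector_derivative_def scaleR_conv_of_real)
  have "((\<lambda>w. w powi m h) has_field_derivative of_int (m h) * z $ h powi (m h - 1)) (at (z $ h))"
    using DERIV_power_int[OF DERIV_ident, of "m h" "z $ h" UNIV] assms(2) by force
  then have "((\<lambda>t. (z $ h + of_real t * c) powi m h) has_vector_derivative
      c * (of_int (m h) * z $ h powi (m h - 1))) (at 0)"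
    using field_vector_diff_chain_at[OF lin] by (simp add: o_def)
  moreover have "bounded_linear (\<lambda>w. of_real (cpart (h \<in> K) w * ?C) :: quat)"
    by (intro bounded_linear_compose[OF bounded_linear_of_real]
        bounded_linear_compose[OF bounded_linear_mult_left] bounded_linear_cpart)
  ultimately show ?thesis
    unfolding eq by (rule bounded_linear.has_vector_derivative[rotated])
qed

text \<open>Passing from \<open>K\<close> to \<open>insert h K\<close> replaces the real part in
  factor \<open>h\<close> by the imaginary part. With \<open>w\<close> the complex derivative of
  that factor, the two equations reduce to \<open>Re w = Im (\<i> * w)\<close> and
  \<open>Re (\<i> * w) = - Im w\<close>.\<close>

lemma holomorphic_monomial_stem:
  assumes "\<And>h z. h \<in> I \<Longrightarrow> z \<in> D \<Longrightarrow> m h < 0 \<Longrightarrow> z $ h \<noteq> 0"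
  shows "holomorphic_stem I D (monomial_stem I m)"
  unfolding holomorphic_stem_def C1_stem_def
proof (intro conjI ballI allI impI)
  show "Ck_on 1 (coord_space I) D (monomial_stem I m K)" for K
    unfolding monomial_stem_def
    by (intro Ck_on_linear_compose[OF bounded_linear_of_real] Ck_on_prod
        Ck_on_linear_compose[OF bounded_linear_cpart] Ck_on_power_int
        Ck_on_bounded_linear[OF bounded_linear_vec_nth] assms)
  show "monomial_stem I m K (conj_var h z) =
      (if h \<in> K then - monomial_stem I m K z else monomial_stem I m K z)" if "h \<in> I" for h K z
    using that by (rule monomial_stem_conj_var)
  fix h K z assume h: "h \<in> I" "h \<notin> K" and z: "z \<in> D"
  note der = vector_derivative_at[OF has_vector_derivative_monomial_stem[of h I m z]]
  have C: "(\<Prod>g\<in>I - {h}. cpart (g \<in> insert h K) (z $ g powi m g)) =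
      (\<Prod>g\<in>I - {h}. cpart (g \<in> K) (z $ g powi m g))"
    by (intro prod.cong) auto
  show "dx h (monomial_stem I m K) z = dy h (monomial_stem I m (insert h K)) z"
    "dy h (monomial_stem I m K) z = - dx h (monomial_stem I m (insert h K)) z"
    using h z assms unfolding dx_def dy_def
    by (simp_all add: der C) (simp_all add: cpart_def)
qed

lemma qpoint_slice_embed: "qpoint x y J $ h = slice_embed (J $ h) (cpoint x y $ h)"
  by (simp add: qpoint_def slice_embed_def cpoint_def)

text \<open>Integer powers commute with \<open>slice_embed\<close>, so each factor of the monomial
  embeds a complex power. Expanding the product in increasing order then gives the defining
  sum.\<close>

lemma left_slice_regular_monomial:
  fixes m :: "'n::{finite,linorder} \<Rightarrow> int"
  assumes "\<And>h z. h \<in> I \<Longrightarrow> z \<in> D \<Longrightarrow> m h < 0 \<Longrightarrow> z $ h \<noteq> 0"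
  shows "left_slice_regular I D (\<lambda>q. prod_list (map (\<lambda>h. q $ h powi m h) (sorted_list_of_set I)))"
  unfolding left_slice_regular_def
proof (intro exI[of _ "monomial_stem I m"] conjI holomorphic_monomial_stem assms allI impI)
  fix x y :: "(real, 'n) vec" and J :: "(quat, 'n) vec"
  assume J: "(\<forall>h. J $ h \<in> imag_units) \<and> cpoint x y \<in> D"
  have "unit_prod J K * monomial_stem I m K (cpoint x y) =
      (\<Prod>h\<in>I. cpart (h \<in> K) (cpoint x y $ h powi m h)) *\<^sub>R
      prod_list (map (($) J) (filter (\<lambda>h. h \<in> K) (sorted_list_of_set I)))" if "K \<in> Pow I" for K
    using that by (simp add: monomial_stem_def unit_prod_def of_real_def
        sorted_list_of_set_subset[of I K])
  then show "prod_list (map (\<lambda>h. qpoint x y J $ h powi m h) (sorted_list_of_set I)) =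
      (\<Sum>K\<in>Pow I. unit_prod J K * monomial_stem I m K (cpoint x y))"
    using sum_cpart_prod_list[of "sorted_list_of_set I" "\<lambda>h. cpoint x y $ h powi m h" "($) J"]
    by (simp add: qpoint_slice_embed J flip: slice_embed_power_int)
qed

lemma right_slice_regular_monomial:
  fixes m :: "'n::{finite,linorder} \<Rightarrow> int"
  assumes "\<And>h z. h \<in> I \<Longrightarrow> z \<in> D \<Longrightarrow> m h < 0 \<Longrightarrow> z $ h \<noteq> 0"
  shows "right_slice_regular I D
    (\<lambda>q. prod_list (map (\<lambda>h. q $ h powi m h) (rev (sorted_list_of_set I))))"
  unfolding right_slice_regular_def
proof (intro exI[of _ "monomial_stem I m"] conjI holomorphic_monomial_stem assms allI impI)
  fix x y :: "(real, 'n) vec" and J :: "(quat, 'n) vec"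
  assume J: "(\<forall>h. J $ h \<in> imag_units) \<and> cpoint x y \<in> D"
  have "monomial_stem I m K (cpoint x y) * unit_prod_rev J K =
      (\<Prod>h\<in>I. cpart (h \<in> K) (cpoint x y $ h powi m h)) *\<^sub>R
      prod_list (map (($) J) (filter (\<lambda>h. h \<in> K) (rev (sorted_list_of_set I))))"
    if "K \<in> Pow I" for K
    using that by (simp add: monomial_stem_def unit_prod_rev_def of_real_def rev_filter
        sorted_list_of_set_subset[of I K])
  then show "prod_list (map (\<lambda>h. qpoint x y J $ h powi m h) (rev (sorted_list_of_set I))) =
      (\<Sum>K\<in>Pow I. monomial_stem I m K (cpoint x y) * unit_prod_rev J K)"
    using sum_cpart_prod_list[of "rev (sorted_list_of_set I)" "\<lambda>h. cpoint x y $ h powi m h" "($) J"]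
    by (simp add: qpoint_slice_embed J rev_map flip: slice_embed_power_int)
qed

text \<open>All other variables of \<open>I\<close> receive exponent 0 and contribute the neutral
  factor. The product has increasing variables if \<open>h < j\<close>, hence is left slice regular,
  and decreasing variables otherwise, hence is right slice regular.\<close>

lemma slice_regular_two_variables:
  fixes h j :: "'n::{finite,linorder}"
  assumes "h \<in> I" "j \<in> I" "h \<noteq> j"
    and "\<And>z. z \<in> D \<Longrightarrow> a < 0 \<Longrightarrow> z $ h \<noteq> 0" "\<And>z. z \<in> D \<Longrightarrow> b < 0 \<Longrightarrow> z $ j \<noteq> 0"
  shows "left_slice_regular I D (\<lambda>q. q $ h powi a * q $ j powi b) \<or>
    right_slice_regular I D (\<lambda>q. q $ h powi a * q $ j powi b)"
proof -
  define m where "m = (\<lambda>_. 0 :: int)(h := a, j := b)"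
  have m: "z $ g \<noteq> 0" if "g \<in> I" "z \<in> D" "m g < 0" for g and z :: "(complex, 'n) vec"
    using that assms by (auto simp: m_def split: if_splits)
  have sub: "filter (\<lambda>g. g \<in> {h, j}) (sorted_list_of_set I) = sorted_list_of_set {h, j}"
    using assms by (intro sorted_list_of_set_subset[symmetric]) auto
  show ?thesis
  proof (cases "h < j")
    case True
    have "prod_list (map (\<lambda>g. q $ g powi m g) (sorted_list_of_set I)) = q $ h powi a * q $ j powi b"
      for q :: "(quat, 'n) vec"
    proof -
      have "prod_list (map (\<lambda>g. q $ g powi m g) (sorted_list_of_set I)) =
          prod_list (map (\<lambda>g. q $ g powi m g) (sorted_list_of_set {h, j}))"
        unfolding sub[symmetric] by (rule prod_list_filter_neutral[symmetric]) (auto simp: m_def)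
      moreover have "sorted_list_of_set {h, j} = [h, j]" using True by auto
      ultimately show ?thesis using assms(3) by (simp add: m_def)
    qed
    then show ?thesis using left_slice_regular_monomial[of I D m, OF m] by simp
  next
    case False
    then have "j < h" using assms(3) by simp
    have "prod_list (map (\<lambda>g. q $ g powi m g) (rev (sorted_list_of_set I))) =
        q $ h powi a * q $ j powi b" for q :: "(quat, 'n) vec"
    proof -
      have "prod_list (map (\<lambda>g. q $ g powi m g) (rev (sorted_list_of_set I))) =
          prod_list (map (\<lambda>g. q $ g powi m g) (rev (sorted_list_of_set {h, j})))"
        unfolding sub[symmetric] rev_filter
        by (rule prod_list_filter_neutral[symmetric]) (auto simp: m_def)
      moreover have "sorted_list_of_set {h, j} = [j, h]" using \<open>j < h\<close> by auto
      ultimately show ?thesis using assms(3) by (simp add: m_def)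
    qed
    then show ?thesis using right_slice_regular_monomial[of I D m, OF m] by simp
  qed
qed

lemma left_slice_regular_one_variable:
  fixes h :: "'n::{finite,linorder}"
  assumes "h \<in> I" "\<And>z. z \<in> D \<Longrightarrow> a < 0 \<Longrightarrow> z $ h \<noteq> 0"
  shows "left_slice_regular I D (\<lambda>q. q $ h powi a)"
proof -
  define m where "m = (\<lambda>_. 0 :: int)(h := a)"
  have m: "z $ g \<noteq> 0" if "g \<in> I" "z \<in> D" "m g < 0" for g and z :: "(complex, 'n) vec"
    using that assms by (auto simp: m_def split: if_splits)
  have sub: "filter (\<lambda>g. g \<in> {h}) (sorted_list_of_set I) = sorted_list_of_set {h}"
    using assms by (intro sorted_list_of_set_subset[symmetric]) auto
  have "prod_list (map (\<lambda>g. q $ g powi m g) (sorted_list_of_set I)) = q $ h powi a"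
    for q :: "(quat, 'n) vec"
  proof -
    have "prod_list (map (\<lambda>g. q $ g powi m g) (sorted_list_of_set I)) =
        prod_list (map (\<lambda>g. q $ g powi m g) (sorted_list_of_set {h}))"
      unfolding sub[symmetric] by (rule prod_list_filter_neutral[symmetric]) (auto simp: m_def)
    then show ?thesis by (simp add: m_def)
  qed
  then show ?thesis using left_slice_regular_monomial[of I D m, OF m] by simp
qed

text \<open>Embedding into a slice neither creates nor destroys zeros, and every quaternion lies in
  a slice. Taking \<open>Z\<close> empty gives the whole coordinate space, and
  \<open>Z = {j}\<close> the overlap with chart \<open>j\<close>.\<close>

lemma circularization_nonzero:
  "circularization {z \<in> coord_space I. \<forall>h\<in>Z. z $ h \<noteq> 0} =
    {b \<in> coord_space I. \<forall>h\<in>Z. b $ h \<noteq> 0}" (is "circularization ?D = ?U")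
proof
  show "circularization ?D \<subseteq> ?U"
    by (auto simp: circularization_def coord_space_def qpoint_slice_embed slice_embed_eq_0_iff)
  show "?U \<subseteq> circularization ?D"
  proof
    fix b assume b: "b \<in> ?U"
    have "\<forall>h. \<exists>J z. J \<in> imag_units \<and> b $ h = slice_embed J z"
      using quat_in_slice by blast
    then obtain J z where Jz: "\<And>h. J h \<in> imag_units" "\<And>h. b $ h = slice_embed (J h) (z h)"
      by metis
    let ?x = "\<chi> h. Re (z h)" and ?y = "\<chi> h. Im (z h)" and ?J = "\<chi> h. J h"
    have c: "cpoint ?x ?y = (\<chi> h. z h)" by (simp add: cpoint_def)
    have "b = qpoint ?x ?y ?J" by (simp add: vec_eq_iff qpoint_slice_embed c Jz(2))
    moreover have "cpoint ?x ?y \<in> ?D"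
      using b by (auto simp: c coord_space_def Jz slice_embed_eq_0_iff)
    ultimately show "b \<in> circularization ?D"
      unfolding circularization_def using Jz(1) by force
  qed
qed

lemma stem_domain_nonzero: "stem_domain I {z \<in> coord_space I. \<forall>h\<in>Z. z $ h \<noteq> 0}"
proof -
  have "{z :: complex ^ 'a. \<forall>h\<in>Z. z $ h \<noteq> 0} = (\<Inter>h\<in>Z. {z. z $ h \<noteq> 0})" by auto
  moreover have "open {z :: complex ^ 'a. z $ h \<noteq> 0}" for h
    by (intro open_Collect_neq continuous_intros)
  ultimately have "open {z :: complex ^ 'a. \<forall>h\<in>Z. z $ h \<noteq> 0}" by auto
  moreover have "{z \<in> coord_space I. \<forall>h\<in>Z. z $ h \<noteq> 0} =
      coord_space I \<inter> {z :: complex ^ 'a. \<forall>h\<in>Z. z $ h \<noteq> 0}" by auto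
  ultimately show ?thesis
    by (auto simp: stem_domain_def openin_open coord_space_def conj_var_def)
qed

section \<open>Slice regularity of the transition maps\<close>

lemma slice_regular_map_cong:
  assumes "\<And>q. q \<in> U \<Longrightarrow> f q = g q" "slice_regular_map I I' U g"
  shows "slice_regular_map I I' U f"
proof -
  obtain D where D: "stem_domain I D" "U = circularization D"
    "\<forall>k\<in>I'. left_slice_regular I D (\<lambda>q. g q $ k) \<or> right_slice_regular I D (\<lambda>q. g q $ k)"
    using assms(2) unfolding slice_regular_map_def by blast
  \<comment> \<open>The slice formulas evaluate the maps only at points of the circularization,
    which is \<open>U\<close>.\<close>
  have "f (qpoint x y J) = g (qpoint x y J)"
    if "(\<forall>h. J $ h \<in> imag_units) \<and> cpoint x y \<in> D" for x y J
    using that assms(1) D(2) unfolding circularization_def by blast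
  then have "left_slice_regular I D (\<lambda>q. f q $ k) \<longleftrightarrow> left_slice_regular I D (\<lambda>q. g q $ k)"
    "right_slice_regular I D (\<lambda>q. f q $ k) \<longleftrightarrow> right_slice_regular I D (\<lambda>q. g q $ k)" for k
    unfolding left_slice_regular_def right_slice_regular_def by (simp_all cong: conj_cong)
  moreover have "smooth_on (coord_space I) U f \<longleftrightarrow> smooth_on (coord_space I) U g"
    unfolding smooth_on_def using Ck_on_cong[of U f g] assms(1) by blast
  moreover have "f ` U = g ` U" using assms(1) by (rule image_cong[OF refl])
  ultimately show ?thesis
    using assms(2) D unfolding slice_regular_map_def by metis
qed

text \<open>The transition from the affine chart \<open>i\<close> of the blow-up to the affine chart \<open>j \<noteq> i\<close>.\<close>
definition blowup_change :: "'n \<Rightarrow> 'n \<Rightarrow> quat ^ 'n \<Rightarrow> quat ^ 'n" where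
  "blowup_change i j b = (\<chi> k. if k = j then b $ j * b $ i
     else if k = i then inverse (b $ j) else b $ k * inverse (b $ j))"

text \<open>The alternative \<open>I = UNIV\<close> serves the blow-up itself;
  \<open>I = - {i}\<close> serves the exceptional set, where coordinate \<open>i\<close> of the
  source chart vanishes and is dropped.\<close>

lemma slice_regular_blowup_change:
  fixes i j :: "'n::{finite,linorder}"
  assumes "i \<noteq> j" "I = UNIV \<and> I' = UNIV \<or> I = - {i} \<and> I' = - {j}"
  shows "slice_regular_map I I' {b \<in> coord_space I. b $ j \<noteq> 0} (blowup_change i j)"
  unfolding slice_regular_map_def
proof (intro conjI exI ballI)
  let ?D = "{z \<in> coord_space I. \<forall>h\<in>{j}. z $ h \<noteq> 0}"
  show "stem_domain I ?D" by (rule stem_domain_nonzero)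
  show "{b \<in> coord_space I. b $ j \<noteq> 0} = circularization ?D"
    unfolding circularization_nonzero by simp
  show "blowup_change i j ` {b \<in> coord_space I. b $ j \<noteq> 0} \<subseteq> coord_space I'"
    \<comment> \<open>In the second alternative, component \<open>j\<close> of the image is
      \<open>b $ j * b $ i\<close>, which is 0 because \<open>b $ i = 0\<close>.\<close>
    using assms by (auto simp: blowup_change_def coord_space_def)
  have C: "Ck_on k (coord_space I) {b \<in> coord_space I. b $ j \<noteq> 0} (\<lambda>b :: (quat, 'n) vec. b $ h)" for k h
    by (rule Ck_on_bounded_linear[OF bounded_linear_vec_nth])
  have "Ck_on k (coord_space I) {b \<in> coord_space I. b $ j \<noteq> 0} (\<lambda>b :: (quat, 'n) vec. inverse (b $ j))" for k
    by (rule Ck_on_inverse[OF C]) simp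
  then have "Ck_on k (coord_space I) {b \<in> coord_space I. b $ j \<noteq> 0} (\<lambda>b :: (quat, 'n) vec. if h = j then b $ j * b $ i
     else if h = i then inverse (b $ j) else b $ h * inverse (b $ j))" for k h
    by (cases "h = j"; cases "h = i") (simp_all add: Ck_on_mult C)
  then show "smooth_on (coord_space I) {b \<in> coord_space I. b $ j \<noteq> 0} (blowup_change i j)"
    unfolding smooth_on_def blowup_change_def by (intro allI Ck_on_vec_lambda)
  fix k assume k: "k \<in> I'"
  consider "k = j" | "k = i" | "k \<noteq> i" "k \<noteq> j" by blast
  then show "left_slice_regular I ?D (\<lambda>q. blowup_change i j q $ k) \<or>
      right_slice_regular I ?D (\<lambda>q. blowup_change i j q $ k)"
  proof cases
    case 1
    then show ?thesis
      using slice_regular_two_variables[of j I i ?D 1 1] k assms by (auto simp: blowup_change_def)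
  next
    case 2
    then show ?thesis
      using left_slice_regular_one_variable[of j I ?D "- 1"] k assms
      by (auto simp: blowup_change_def power_int_minus)
  next
    case 3
    then show ?thesis
      using slice_regular_two_variables[of k I j ?D 1 "- 1"] k assms
      by (auto simp: blowup_change_def power_int_minus)
  qed
qed

lemma slice_regular_map_id: "slice_regular_map I I (coord_space I) (\<lambda>b. b)"
  unfolding slice_regular_map_def
proof (intro conjI exI ballI)
  let ?D = "{z \<in> coord_space I. \<forall>h\<in>{}. z $ h \<noteq> 0}"
  show "stem_domain I ?D" by (rule stem_domain_nonzero)
  show "coord_space I = circularization ?D" unfolding circularization_nonzero by simp
  show "smooth_on (coord_space I) (coord_space I) (\<lambda>b. b)"
    unfolding smooth_on_def by (intro allI Ck_on_bounded_linear bounded_linear_ident)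
  show "left_slice_regular I ?D (\<lambda>b. b $ k) \<or> right_slice_regular I ?D (\<lambda>b. b $ k)"
    if "k \<in> I" for k
    using left_slice_regular_one_variable[of k I ?D 1] that by simp
qed simp

section \<open>Projective space and the charts of the blow-up\<close>

lemma second_countable_euclidean:
  "second_countable (euclidean :: 'a::second_countable_topology topology)"
proof -
  obtain B :: "'a set set" where B: "countable B" "topological_basis B"
    using ex_countable_basis by blast
  then show ?thesis
    unfolding second_countable_def
    by (metis open_openin topological_basis_open topological_basisE)
qed

text \<open>The union of countable bases of the pieces is a basis of the whole space, since sets
  open in an open piece are open in \<open>X\<close>.\<close>

lemma second_countable_open_cover:
  assumes "countable I" "\<And>i. i \<in> I \<Longrightarrow> openin X (U i)" "topspace X \<subseteq> (\<Union>i\<in>I. U i)"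
    and "\<And>i. i \<in> I \<Longrightarrow> second_countable (subtopology X (U i))"
  shows "second_countable X"
proof -
  obtain B where B: "\<And>i. i \<in> I \<Longrightarrow> countable (B i)"
    "\<And>i V. i \<in> I \<Longrightarrow> V \<in> B i \<Longrightarrow> openin (subtopology X (U i)) V"
    "\<And>i W x. i \<in> I \<Longrightarrow> openin (subtopology X (U i)) W \<Longrightarrow> x \<in> W \<Longrightarrow> \<exists>V\<in>B i. x \<in> V \<and> V \<subseteq> W"
    using assms(4) unfolding second_countable_def by metis
  show ?thesis
    unfolding second_countable_def
  proof (intro exI[of _ "\<Union>i\<in>I. B i"] conjI ballI allI impI)
    show "countable (\<Union>i\<in>I. B i)" using assms(1) B(1) by blast
    show "openin X V" if "V \<in> (\<Union>i\<in>I. B i)" for V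
      using that B(2) assms(2) by (auto simp: openin_open_subtopology)
    fix W x assume W: "openin X W \<and> x \<in> W"
    then obtain i where i: "i \<in> I" "x \<in> U i"
      using assms(3) openin_subset by blast
    then have "openin (subtopology X (U i)) (W \<inter> U i)"
      using W by (simp add: openin_subtopology_Int)
    then show "\<exists>V\<in>\<Union>i\<in>I. B i. x \<in> V \<and> V \<subseteq> W"
      using B(3)[of i "W \<inter> U i" x] i W by blast
  qed
qed

section \<open>Right quaternionic lines and the projective quotient map\<close>

definition rscale :: "quat ^ 'n \<Rightarrow> quat \<Rightarrow> quat ^ 'n" where
  "rscale a l = (\<chi> h. a $ h * l)"

lemma rscale_nth [simp]: "rscale a l $ h = a $ h * l"
  by (simp add: rscale_def)

lemma rscale_rscale: "rscale (rscale a l) m = rscale a (l * m)"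
  by (simp add: vec_eq_iff mult.assoc)

lemma mem_qline_iff: "b \<in> qline a \<longleftrightarrow> (\<exists>l. b = rscale a l)"
  by (auto simp: qline_def rscale_def)

lemma mem_qline_self [simp]: "a \<in> qline a"
proof -
  have "a = rscale a 1" by (simp add: vec_eq_iff)
  then show ?thesis using mem_qline_iff by blast
qed

lemma qline_rscale:
  assumes "l \<noteq> 0"
  shows "qline (rscale a l) = qline a"
proof -
  have "rscale a m = rscale (rscale a l) (inverse l * m)" for m
    using assms by (simp add: rscale_rscale flip: mult.assoc)
  then show ?thesis by (auto simp: set_eq_iff mem_qline_iff rscale_rscale)
qed

lemma rscale_0_right [simp]: "rscale a 0 = 0"
  by (simp add: vec_eq_iff)

lemma qline_eq_if_mem:
  assumes "b \<in> qline a" "b \<noteq> 0"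
  shows "qline b = qline a"
  using assms by (metis mem_qline_iff qline_rscale rscale_0_right)

lemma HP_cases:
  assumes "l \<in> HP"
  obtains a where "a \<noteq> 0" "l = qline a"
  using assms by (auto simp: HP_def)

lemma qline_in_HP: "a \<noteq> 0 \<Longrightarrow> qline a \<in> HP"
  by (auto simp: HP_def)

lemma topspace_HP_topology [simp]: "topspace HP_topology = HP"
proof -
  have "{a :: quat ^ 'a. a \<noteq> 0 \<and> qline a \<in> HP} = - {0}" by (auto simp: qline_in_HP)
  then have "openin HP_topology (HP :: (quat ^ 'a) set set)" by (simp add: openin_HP_topology open_Compl)
  then show ?thesis
    by (metis openin_HP_topology openin_subset openin_topspace subset_antisym)
qed

text \<open>Reduces continuity of maps defined on projective space to continuity on nonzero
  vectors.\<close>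

lemma quotient_map_qline: "quotient_map (top_of_set (- {0})) HP_topology qline"
proof -
  have "{a. a \<in> - {0} \<and> qline a \<in> W} = {a. a \<noteq> 0 \<and> qline a \<in> W}" for W :: "(quat ^ 'a) set set"
    by auto
  moreover have "openin (top_of_set (- {0})) {a. a \<noteq> 0 \<and> qline a \<in> W} \<longleftrightarrow>
      open {a. a \<noteq> 0 \<and> qline a \<in> W}" for W :: "(quat ^ 'a) set set"
    by (subst openin_open_eq) (auto simp: open_Compl)
  moreover have "qline ` (- {0}) = (HP :: (quat ^ 'a) set set)"
    by (simp add: HP_def Compl_eq_Diff_UNIV)
  ultimately show ?thesis
    by (simp add: quotient_map_def openin_HP_topology)
qed

section \<open>Hausdorff property of projective space and the blow-up\<close>

definition qconj :: "quat \<Rightarrow> quat" where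
  "qconj q = (norm q)\<^sup>2 *\<^sub>R inverse q"

lemma qconj_mult: "qconj (x * y) = qconj y * qconj x"
proof (cases "x = 0 \<or> y = 0")
  case False
  then show ?thesis
    by (simp add: qconj_def norm_mult power_mult_distrib nonzero_inverse_mult_distrib)
qed (auto simp: qconj_def)

lemma mult_qconj: "q * qconj q = of_real ((norm q)\<^sup>2)"
  by (cases "q = 0") (simp_all add: qconj_def of_real_def)

lemma qconj_eq_0_iff [simp]: "qconj q = 0 \<longleftrightarrow> q = 0"
  by (auto simp: qconj_def)

text \<open>Since \<open>inner q 1\<close> is the real part, this is the usual conjugate. The
  definition by \<open>inverse\<close> suits products and norms, while this real-linear form shows
  continuity, also at 0.\<close>

lemma qconj_eq: "qconj q = of_real (2 * inner q 1) - q"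
  by (cases "q = 0") (simp_all add: qconj_def quat_eq_iff inner_quat_def norm_quat_def
      del: of_real_mult)

lemma continuous_on_qconj [continuous_intros]:
  "continuous_on S f \<Longrightarrow> continuous_on S (\<lambda>x. qconj (f x))"
  unfolding qconj_eq by (intro continuous_intros)

lemma norm_rscale: "norm (rscale a l) = norm a * norm l"
  by (simp add: norm_vec_def L2_set_def norm_mult power_mult_distrib real_sqrt_mult
      flip: sum_distrib_right)

text \<open>The matrix of the orthogonal projection onto the line spanned by \<open>a\<close>.\<close>
definition line_projection :: "quat ^ 'n \<Rightarrow> quat ^ 'n ^ 'n" where
  "line_projection a = (\<chi> h k. inverse ((norm a)\<^sup>2) *\<^sub>R (a $ h * qconj (a $ k)))"

text \<open>The factor \<open>l * qconj l\<close> arising in the middle of each entry is the real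
  number \<open>(norm l)^2\<close>, which the normalisation by the norm cancels.\<close>

lemma line_projection_rscale:
  assumes "l \<noteq> 0"
  shows "line_projection (rscale a l) = line_projection a"
proof -
  have "(a $ h * l) * qconj (a $ k * l) = (norm l)\<^sup>2 *\<^sub>R (a $ h * qconj (a $ k))" for h k
    by (simp add: qconj_mult mult.assoc[of _ l] mult.assoc[of l, symmetric] mult_qconj
        of_real_def del: of_real_power)
  then show ?thesis
    using assms by (simp add: line_projection_def norm_rscale power_mult_distrib vec_eq_iff)
qed

lemma qline_eq_if_line_projection_eq:
  assumes "a \<noteq> 0" "b \<noteq> 0" "line_projection a = line_projection b"
  shows "qline a = qline b"
proof -
  obtain k where k: "a $ k \<noteq> 0" using assms(1) by (auto simp: vec_eq_iff)
  \<comment> \<open>Obtained by solving the equality of the \<open>k\<close>-th columns of the two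
    matrices for \<open>a $ h\<close>; the resulting right factor is the same for all
    \<open>h\<close>.\<close>
  define l where "l = ((norm a)\<^sup>2 * inverse ((norm b)\<^sup>2)) *\<^sub>R (qconj (b $ k) * inverse (qconj (a $ k)))"
  have "a $ h = b $ h * l" for h
  proof -
    have "inverse ((norm a)\<^sup>2) *\<^sub>R (a $ h * qconj (a $ k)) =
        inverse ((norm b)\<^sup>2) *\<^sub>R (b $ h * qconj (b $ k))"
      using assms(3) by (simp add: line_projection_def vec_eq_iff)
    then have "(norm a)\<^sup>2 *\<^sub>R (inverse ((norm a)\<^sup>2) *\<^sub>R (a $ h * qconj (a $ k))) =
        (norm a)\<^sup>2 *\<^sub>R (inverse ((norm b)\<^sup>2) *\<^sub>R (b $ h * qconj (b $ k)))"
      by (rule arg_cong)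
    then have "a $ h * qconj (a $ k) =
        ((norm a)\<^sup>2 * inverse ((norm b)\<^sup>2)) *\<^sub>R (b $ h * qconj (b $ k))"
      using assms(1) by simp
    then have "(a $ h * qconj (a $ k)) * inverse (qconj (a $ k)) = b $ h * l"
      by (simp add: l_def mult.assoc)
    then show ?thesis using k by (simp add: mult.assoc)
  qed
  then have "a \<in> qline b" by (auto simp: mem_qline_iff vec_eq_iff)
  then show ?thesis using assms(1) by (rule qline_eq_if_mem)
qed

lemma Hausdorff_space_HP_topology: "Hausdorff_space (HP_topology :: (quat ^ 'n::finite) set topology)"
proof -
  define g where "g l = line_projection (SOME a. a \<noteq> 0 \<and> qline a = l)" for l :: "(quat ^ 'n) set"
  \<comment> \<open>Two nonzero representatives of a line differ by a nonzero right factor, so the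
    choice made in \<open>g\<close> is immaterial.\<close>
  have g: "g (qline a) = line_projection a" if "a \<noteq> 0" for a
  proof -
    let ?b = "SOME b. b \<noteq> 0 \<and> qline b = qline a"
    have b: "?b \<noteq> 0 \<and> qline ?b = qline a"
      by (rule someI[of "\<lambda>b. b \<noteq> 0 \<and> qline b = qline a" a]) (simp add: that)
    have "a \<in> qline ?b" using b by (metis mem_qline_self)
    then obtain l where l: "a = rscale ?b l" using mem_qline_iff by blast
    then have "l \<noteq> 0" using that by auto
    then show ?thesis
      unfolding g_def using l line_projection_rscale by metis
  qed
  have "continuous_on (- {0}) (line_projection :: quat ^ 'n \<Rightarrow> _)"
    unfolding line_projection_def by (intro continuous_intros) simp
  then have "continuous_on (- {0}) (g \<circ> qline)"
    by (rule continuous_on_eq) (simp add: g)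
  then have "continuous_map HP_topology euclidean g"
    by (intro continuous_compose_quotient_map[OF quotient_map_qline]) simp
  moreover have "inj_on g HP"
    by (rule inj_onI) (metis HP_cases g qline_eq_if_line_projection_eq)
  ultimately show ?thesis
    by (intro Hausdorff_space_injective_preimage[OF Hausdorff_space_euclidean]) simp_all
qed

lemma exceptional_set_subset: "exceptional_set \<subseteq> blowup"
  by (simp add: blowup_def)

lemma blowup_subset: "blowup \<subseteq> UNIV \<times> HP"
  by (auto simp: blowup_def exceptional_set_def)

lemma topspace_blowup_topology [simp]: "topspace blowup_topology = blowup"
  using blowup_subset by (auto simp: blowup_topology_def)

lemma Hausdorff_space_blowup_topology: "Hausdorff_space blowup_topology"
  unfolding blowup_topology_def
  by (intro Hausdorff_space_subtopology)
    (simp add: Hausdorff_space_prod_topology Hausdorff_space_HP_topology)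

text \<open>Zero lies on every line, so the graph and the exceptional set obey the same incidence
  condition.\<close>

lemma mem_blowup_qline_iff:
  assumes "a \<noteq> 0"
  shows "(q, qline a) \<in> blowup \<longleftrightarrow> q \<in> qline a"
proof -
  have "0 = rscale a 0" by simp
  then have "0 \<in> qline a" using mem_qline_iff by blast
  then show ?thesis using assms by (auto simp: blowup_def exceptional_set_def qline_in_HP)
qed

section \<open>Affine charts of projective space and of the blow-up\<close>

definition HP_affine :: "'n \<Rightarrow> (quat ^ 'n) set set" where
  "HP_affine i = {l \<in> HP. \<exists>a\<in>l. a $ i \<noteq> 0}"

definition affine_rep :: "'n \<Rightarrow> (quat ^ 'n) set \<Rightarrow> quat ^ 'n" where
  "affine_rep i l = (THE b. b \<in> l \<and> b $ i = 1)"

lemma qline_in_HP_affine_iff: "a \<noteq> 0 \<and> qline a \<in> HP_affine i \<longleftrightarrow> a $ i \<noteq> 0"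
proof -
  have "(\<exists>b\<in>qline a. b $ i \<noteq> 0) \<longleftrightarrow> a $ i \<noteq> 0"
    using mem_qline_self[of a] by (auto simp: mem_qline_iff)
  then show ?thesis by (auto simp: HP_affine_def intro: qline_in_HP)
qed

lemma HP_affine_cases:
  assumes "l \<in> HP_affine i"
  obtains a where "a $ i \<noteq> 0" "l = qline a"
  using assms qline_in_HP_affine_iff HP_affine_def by (metis (no_types, lifting) HP_cases mem_Collect_eq)

lemma affine_rep_qline:
  assumes "a $ i \<noteq> 0"
  shows "affine_rep i (qline a) = rscale a (inverse (a $ i))"
  unfolding affine_rep_def
proof (rule the_equality)
  have "rscale a (inverse (a $ i)) \<in> qline a" using mem_qline_iff by blast
  then show "rscale a (inverse (a $ i)) \<in> qline a \<and> rscale a (inverse (a $ i)) $ i = 1"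
    using assms by simp
  show "b = rscale a (inverse (a $ i))" if "b \<in> qline a \<and> b $ i = 1" for b
  proof -
    from that have "b \<in> qline a" by simp
    then obtain l where l: "b = rscale a l" unfolding mem_qline_iff by (elim exE)
    then have "a $ i * l = 1" using that by simp
    then have "inverse (a $ i) = l" by (rule inverse_unique)
    then show ?thesis by (simp add: l)
  qed
qed

lemma openin_HP_affine: "openin HP_topology (HP_affine i)"
proof -
  have "open {a :: quat ^ 'a. a $ i \<noteq> 0}"
    by (intro open_Collect_neq continuous_intros)
  moreover have "HP_affine i \<subseteq> HP" by (auto simp: HP_affine_def)
  ultimately show ?thesis
    by (simp add: openin_HP_topology qline_in_HP_affine_iff)
qed

text \<open>The quotient map restricts to the preimage of the open set \<open>HP_affine i\<close>.
  On vectors, the normalised representative is \<open>rscale a (inverse (a $ i))\<close>, which is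
  visibly continuous.\<close>

lemma continuous_map_affine_rep:
  "continuous_map (subtopology HP_topology (HP_affine i)) euclidean (affine_rep i)"
proof -
  have "quotient_map (subtopology (top_of_set (- {0})) {a. a $ i \<noteq> 0})
      (subtopology HP_topology (HP_affine i)) qline"
    using quotient_map_restriction[OF quotient_map_qline, of "HP_affine i" "{a. a $ i \<noteq> 0}"]
      openin_HP_affine[of i] by (auto simp: qline_in_HP_affine_iff)
  moreover have "continuous_on {a. a $ i \<noteq> 0} (affine_rep i \<circ> qline)"
  proof (rule continuous_on_eq)
    show "continuous_on {a. a $ i \<noteq> 0} (\<lambda>a. rscale a (inverse (a $ i)))"
      unfolding rscale_def by (intro continuous_intros) simp
  qed (simp add: affine_rep_qline)
  moreover have "- {0} \<inter> {a :: quat ^ 'a. a $ i \<noteq> 0} = {a. a $ i \<noteq> 0}" by auto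
  ultimately show ?thesis
    by (intro continuous_compose_quotient_map[of "top_of_set {a. a $ i \<noteq> 0}" _ qline])
      (simp_all add: subtopology_subtopology)
qed

definition blowup_affine :: "'n \<Rightarrow> ((quat ^ 'n) \<times> (quat ^ 'n) set) set" where
  "blowup_affine i = {p \<in> blowup. snd p \<in> HP_affine i}"

definition blowup_coord :: "'n \<Rightarrow> (quat ^ 'n) \<times> (quat ^ 'n) set \<Rightarrow> quat ^ 'n" where
  "blowup_coord i p = (\<chi> h. if h = i then fst p $ i else affine_rep i (snd p) $ h)"

text \<open>Slot \<open>i\<close> of the chart coordinates stores the entry \<open>i\<close> of the
  point and not of the line. Replacing it by 1 recovers the normalised representative of the
  line.\<close>

definition unit_coord :: "'n \<Rightarrow> quat ^ 'n \<Rightarrow> quat ^ 'n" where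
  "unit_coord i b = (\<chi> h. if h = i then 1 else b $ h)"

text \<open>Inverse of the chart: the representative has entry 1 at \<open>i\<close>, so a point of
  its line is the representative times the point's own entry \<open>i\<close>.\<close>

definition blowup_param :: "'n \<Rightarrow> quat ^ 'n \<Rightarrow> (quat ^ 'n) \<times> (quat ^ 'n) set" where
  "blowup_param i b = (rscale (unit_coord i b) (b $ i), qline (unit_coord i b))"

lemma unit_coord_nth: "unit_coord i b $ h = (if h = i then 1 else b $ h)"
  by (simp add: unit_coord_def)

lemma unit_coord_nonzero: "unit_coord i b \<noteq> 0"
  by (metis unit_coord_nth zero_index zero_neq_one)

text \<open>Describes the overlap with chart \<open>j\<close> in the coordinates of chart
  \<open>i\<close>: the condition is that entry \<open>j\<close> of the representative is
  nonzero.\<close>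

lemma blowup_param_in_affine_iff: "blowup_param i b \<in> blowup_affine j \<longleftrightarrow> i = j \<or> b $ j \<noteq> 0"
proof -
  have "blowup_param i b \<in> blowup"
    unfolding blowup_param_def mem_blowup_qline_iff[OF unit_coord_nonzero] mem_qline_iff by blast
  then show ?thesis
    using qline_in_HP_affine_iff[of "unit_coord i b" j]
    by (auto simp: blowup_affine_def blowup_param_def unit_coord_nonzero unit_coord_nth)
qed

lemma blowup_coord_param:
  assumes "unit_coord i b $ j \<noteq> 0"
  shows "blowup_coord j (blowup_param i b) = (\<chi> h. if h = j then unit_coord i b $ j * b $ i
    else unit_coord i b $ h * inverse (unit_coord i b $ j))"
  using assms by (simp add: vec_eq_iff blowup_coord_def blowup_param_def affine_rep_qline)

lemma blowup_param_coord:
  assumes "p \<in> blowup_affine i"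
  shows "blowup_param i (blowup_coord i p) = p"
proof -
  obtain a where a: "a $ i \<noteq> 0" "snd p = qline a"
    using assms HP_affine_cases unfolding blowup_affine_def by blast
  then have "a \<noteq> 0" by auto
  then obtain l where l: "fst p = rscale a l"
    using assms a mem_blowup_qline_iff[of a "fst p"] unfolding blowup_affine_def
    by (metis (no_types, lifting) mem_Collect_eq mem_qline_iff prod.collapse)
  have u: "unit_coord i (blowup_coord i p) = rscale a (inverse (a $ i))"
    using a by (simp add: vec_eq_iff unit_coord_nth blowup_coord_def affine_rep_qline)
  \<comment> \<open>With the point written as \<open>a\<close> times \<open>l\<close>, its entry
    \<open>i\<close> is \<open>a $ i * l\<close>, and the factor \<open>a $ i\<close> cancels
    against the normalisation of the line.\<close>
  have "blowup_coord i p $ i = a $ i * l" by (simp add: blowup_coord_def l)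
  moreover have "rscale (rscale a (inverse (a $ i))) (a $ i * l) = rscale a l"
    using a(1) by (simp add: rscale_rscale flip: mult.assoc)
  moreover have "qline (rscale a (inverse (a $ i))) = qline a"
    using a(1) by (simp add: qline_rscale)
  ultimately show ?thesis
    by (simp add: blowup_param_def u prod_eq_iff l a(2))
qed

lemma openin_blowup_affine: "openin blowup_topology (blowup_affine i)"
proof -
  have "continuous_map blowup_topology HP_topology snd"
    unfolding blowup_topology_def by (intro continuous_map_from_subtopology continuous_map_snd)
  from openin_continuous_map_preimage[OF this openin_HP_affine[of i]] show ?thesis
    by (simp add: blowup_affine_def)
qed

text \<open>The chart is a continuous function of the point and the normalised representative of its
  line. Its inverse is continuous because \<open>unit_coord i\<close> is a continuous map into the
  nonzero vectors, followed by the quotient projection.\<close>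

lemma homeomorphic_maps_blowup_coord:
  "homeomorphic_maps (subtopology blowup_topology (blowup_affine i)) euclidean
    (blowup_coord i) (blowup_param i)"
  unfolding homeomorphic_maps_def
proof (intro conjI ballI)
  let ?X = "subtopology blowup_topology (blowup_affine i)"
  have fst: "continuous_map ?X euclidean fst"
    unfolding blowup_topology_def by (intro continuous_map_from_subtopology continuous_map_fst)
  have "continuous_map ?X HP_topology snd"
    unfolding blowup_topology_def by (intro continuous_map_from_subtopology continuous_map_snd)
  then have "continuous_map ?X (subtopology HP_topology (HP_affine i)) snd"
    by (rule continuous_map_into_subtopology) (auto simp: blowup_affine_def)
  then have "continuous_map ?X euclidean (affine_rep i \<circ> snd)"
    using continuous_map_affine_rep by (rule continuous_map_compose)
  with fst have "continuous_map ?X (prod_topology euclidean euclidean)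
      (\<lambda>p. (fst p, affine_rep i (snd p)))"
    by (simp only: continuous_map_pairwise) (simp add: o_def)
  then have pair: "continuous_map ?X euclidean (\<lambda>p. (fst p, affine_rep i (snd p)))"
    by (simp add: euclidean_product_topology)
  have "continuous_on UNIV (\<lambda>p. if h = i then fst p $ i else (snd p :: quat ^ 'a) $ h)" for h
    by (cases "h = i") (auto intro!: continuous_intros)
  then have "continuous_on UNIV (\<lambda>(q, r). \<chi> h. if h = i then q $ i else (r :: quat ^ 'a) $ h)"
    unfolding case_prod_beta by (rule continuous_on_vec_lambda)
  then have "continuous_map euclidean euclidean
      (\<lambda>(q, r). \<chi> h. if h = i then q $ i else (r :: quat ^ 'a) $ h)" by simp
  from continuous_map_compose[OF pair this] show "continuous_map ?X euclidean (blowup_coord i)"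
    by (simp add: o_def blowup_coord_def[abs_def])
next
  have "continuous_on UNIV (\<lambda>b :: quat ^ 'a. if h = i then 1 else b $ h)" for h
    by (cases "h = i") (auto intro!: continuous_intros)
  then have u: "continuous_on UNIV (unit_coord i :: quat ^ 'a \<Rightarrow> quat ^ 'a)"
    unfolding unit_coord_def by (rule continuous_on_vec_lambda)
  then have "continuous_map euclidean (top_of_set (- {0})) (unit_coord i)"
    by (simp add: continuous_map_in_subtopology unit_coord_nonzero image_subset_iff)
  from continuous_map_compose[OF this quotient_imp_continuous_map[OF quotient_map_qline]]
  have "continuous_map euclidean HP_topology (snd \<circ> blowup_param i)"
    by (simp add: o_def blowup_param_def)
  moreover have "continuous_on UNIV (fst \<circ> blowup_param i)"
    using u by (auto simp: o_def blowup_param_def rscale_def intro!: continuous_intros)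
  ultimately have "continuous_map euclidean (prod_topology euclidean HP_topology) (blowup_param i)"
    by (simp add: continuous_map_pairwise)
  moreover have "blowup_param i b \<in> blowup_affine i" for b
    by (simp add: blowup_param_in_affine_iff)
  moreover have "blowup_affine i \<subseteq> blowup" by (auto simp: blowup_affine_def)
  ultimately show "continuous_map euclidean (subtopology blowup_topology (blowup_affine i))
      (blowup_param i)"
    unfolding blowup_topology_def by (auto simp: continuous_map_in_subtopology)
next
  show "blowup_param i (blowup_coord i p) = p"
    if "p \<in> topspace (subtopology blowup_topology (blowup_affine i))" for p
    using that by (simp add: blowup_param_coord)
  show "blowup_coord i (blowup_param i b) = b" for b
    by (subst blowup_coord_param) (auto simp: unit_coord_nth vec_eq_iff)
qed

section \<open>The atlas of the blow-up and of the exceptional set\<close>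

lemma Union_blowup_affine:
  "(\<Union>i. blowup_affine i) = (blowup :: ((quat ^ 'n::finite) \<times> (quat ^ 'n) set) set)"
    (is "?U = ?X")
proof
  show "?X \<subseteq> ?U"
  proof
    fix p :: "(quat ^ 'n) \<times> (quat ^ 'n) set" assume p: "p \<in> blowup"
    then have "snd p \<in> HP" using blowup_subset by (metis mem_Times_iff subsetD)
    then obtain a where a: "a \<noteq> 0" "snd p = qline a" by (rule HP_cases)
    then obtain i where "a $ i \<noteq> 0" by (auto simp: vec_eq_iff)
    then have "p \<in> blowup_affine i"
      using p a qline_in_HP_affine_iff[of a i] by (simp add: blowup_affine_def)
    then show "p \<in> (\<Union>i. blowup_affine i)" by blast
  qed
qed (auto simp: blowup_affine_def)

lemma second_countable_blowup_topology:
  "second_countable (blowup_topology :: ((quat ^ 'n::finite) \<times> (quat ^ 'n) set) topology)"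
proof (rule second_countable_open_cover[where I = UNIV and U = blowup_affine])
  show "topspace blowup_topology \<subseteq> (\<Union>i. blowup_affine i :: ((quat ^ 'n) \<times> (quat ^ 'n) set) set)"
    by (simp add: Union_blowup_affine)
  show "second_countable (subtopology blowup_topology (blowup_affine i))"
    for i :: 'n
    using homeomorphic_space_second_countability second_countable_euclidean
      homeomorphic_maps_imp_homeomorphic_space[OF homeomorphic_maps_blowup_coord[of i]] by blast
qed (simp_all add: openin_blowup_affine countable_finite)

lemma blowup_coord_param_inverse: "blowup_coord i (blowup_param i b) = b"
  using homeomorphic_maps_blowup_coord[of i] by (simp add: homeomorphic_maps_def)

lemma blowup_coord_image:
  assumes "\<And>b. blowup_param i b \<in> S \<longleftrightarrow> b \<in> C"
  shows "blowup_coord i ` (S \<inter> blowup_affine i) = C"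
proof
  show "blowup_coord i ` (S \<inter> blowup_affine i) \<subseteq> C"
    using assms blowup_param_coord by fastforce
  show "C \<subseteq> blowup_coord i ` (S \<inter> blowup_affine i)"
  proof
    fix b assume "b \<in> C"
    then have "blowup_param i b \<in> S \<inter> blowup_affine i"
      by (simp add: assms blowup_param_in_affine_iff)
    then show "b \<in> blowup_coord i ` (S \<inter> blowup_affine i)"
      by (metis blowup_coord_param_inverse image_eqI)
  qed
qed

text \<open>Treats the blow-up and the exceptional set together: in every affine chart each is a
  coordinate subspace, with \<open>I i = UNIV\<close> and \<open>I i = - {i}\<close> respectively,
  and both use the same coordinates and transitions.\<close>

lemma blowup_manifold_subset:
  fixes S :: "((quat, 'n::{finite,linorder}) vec \<times> (quat, 'n) vec set) set"
  assumes S: "S \<subseteq> blowup" "\<And>i b. blowup_param i b \<in> S \<longleftrightarrow> b \<in> coord_space (I i)"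
    and I: "(\<forall>i. I i = UNIV) \<or> (\<forall>i. I i = - {i})" and d: "\<And>i. d = 4 * card (I i)"
  shows "quaternionic_regular_manifold d (subtopology blowup_topology S)
    {(I i, S \<inter> blowup_affine i, blowup_coord i) | i. True}"
proof -
  have image: "blowup_coord i ` (S \<inter> blowup_affine i \<inter> (S \<inter> blowup_affine j)) =
      {b \<in> coord_space (I i). i = j \<or> b $ j \<noteq> 0}" for i j
    using blowup_coord_image[of i "S \<inter> blowup_affine j" "{b \<in> coord_space (I i). i = j \<or> b $ j \<noteq> 0}"]
    by (simp add: S(2) blowup_param_in_affine_iff Int_ac)
  have image': "blowup_coord i ` (S \<inter> blowup_affine i) = coord_space (I i)" for i
    by (rule blowup_coord_image) (rule S(2))
  have inv_into: "inv_into (S \<inter> blowup_affine i) (blowup_coord i) b = blowup_param i b"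
    if "b \<in> coord_space (I i)" for i b
  proof -
    have "blowup_param i b \<in> S \<inter> blowup_affine i"
      using that by (simp add: S blowup_param_in_affine_iff)
    moreover have "inj_on (blowup_coord i) (S \<inter> blowup_affine i)"
      by (rule inj_onI) (metis Int_iff blowup_param_coord)
    ultimately show ?thesis by (metis blowup_coord_param_inverse inv_into_f_f)
  qed
  have "is_qchart d (subtopology blowup_topology S) (I i, S \<inter> blowup_affine i, blowup_coord i)" for i
  proof -
    have "homeomorphic_map (subtopology blowup_topology (blowup_affine i)) euclidean (blowup_coord i)"
      using homeomorphic_maps_blowup_coord homeomorphic_maps_imp_map by blast
    moreover have "topspace (subtopology blowup_topology (blowup_affine i)) \<inter> S = S \<inter> blowup_affine i"
      using S(1) by auto
    ultimately have "homeomorphic_map (subtopology (subtopology blowup_topology (blowup_affine i)) S)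
        (subtopology euclidean (coord_space (I i))) (blowup_coord i)"
      by (intro homeomorphic_map_subtopologies) (simp_all add: image')
    then have "homeomorphic_map (subtopology (subtopology blowup_topology S) (S \<inter> blowup_affine i))
        (subtopology euclidean (coord_space (I i))) (blowup_coord i)"
      by (simp add: subtopology_subtopology Int_commute Int_left_commute)
    then show ?thesis
      by (simp add: is_qchart_def image' d openin_blowup_affine openin_subtopology_Int2)
  qed
  moreover have "slice_regular_transition (I i, S \<inter> blowup_affine i, blowup_coord i)
      (I j, S \<inter> blowup_affine j, blowup_coord j)" for i j
  proof (cases "i = j")
    case True
    have "slice_regular_map (I i) (I i) (coord_space (I i))
        (blowup_coord i \<circ> inv_into (S \<inter> blowup_affine i) (blowup_coord i))"
      by (rule slice_regular_map_cong[OF _ slice_regular_map_id]) (simp add: inv_into blowup_coord_param_inverse)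
    then show ?thesis using True by (simp add: slice_regular_transition_def image')
  next
    case False
    have "slice_regular_map (I i) (I j) {b \<in> coord_space (I i). b $ j \<noteq> 0}
        (blowup_coord j \<circ> inv_into (S \<inter> blowup_affine i) (blowup_coord i))"
    proof (rule slice_regular_map_cong)
      show "slice_regular_map (I i) (I j) {b \<in> coord_space (I i). b $ j \<noteq> 0} (blowup_change i j)"
        using I False by (intro slice_regular_blowup_change) auto
      show "(blowup_coord j \<circ> inv_into (S \<inter> blowup_affine i) (blowup_coord i)) b =
          blowup_change i j b" if "b \<in> {b \<in> coord_space (I i). b $ j \<noteq> 0}" for b
        \<comment> \<open>On the overlap the inverse chart is \<open>blowup_param i\<close>, and
          entry \<open>j\<close> of \<open>unit_coord i b\<close> is \<open>b $ j\<close> because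
          the indices differ.\<close>
        using that False
        by (simp add: inv_into blowup_coord_param unit_coord_nth blowup_change_def vec_eq_iff)
    qed
    then show ?thesis using False image[of i j] by (simp add: slice_regular_transition_def)
  qed
  moreover have "(\<Union>i. S \<inter> blowup_affine i) = topspace (subtopology blowup_topology S)"
    using S(1) by (simp add: Union_blowup_affine Int_commute flip: Int_UN_distrib)
  moreover have "{(I i, S \<inter> blowup_affine i, blowup_coord i) | i. True} =
      range (\<lambda>i. (I i, S \<inter> blowup_affine i, blowup_coord i))" by auto
  ultimately have "regular_atlas d (subtopology blowup_topology S)
      {(I i, S \<inter> blowup_affine i, blowup_coord i) | i. True}"
    by (simp only: regular_atlas_def ball_simps image_image prod.case) simp
  then show ?thesis
    by (simp add: quaternionic_regular_manifold_def Hausdorff_space_subtopology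
        Hausdorff_space_blowup_topology second_countable_subtopology second_countable_blowup_topology)
qed

theorem theorem3p7:
  shows "\<exists>A :: ((quat ^ 'n::{finite,linorder}) \<times> (quat ^ 'n::{finite,linorder}) set, 'n) qchart set.
    quaternionic_regular_manifold (4 * CARD('n)) blowup_topology A \<and>
    quaternionic_submanifold (4 * CARD('n) - 4) blowup_topology A exceptional_set"
proof -
  \<comment> \<open>The intersection with \<open>blowup\<close> changes nothing; it gives the charts
    the shape of \<open>blowup_manifold_subset\<close> with \<open>S = blowup\<close>.\<close>
  let ?A = "{(UNIV, blowup \<inter> blowup_affine i, blowup_coord i) | i :: 'n. True}"
  let ?B = "{(i, UNIV, blowup \<inter> blowup_affine i, blowup_coord i) | i :: 'n. True}"
  have param: "blowup_param i b \<in> blowup" for i and b :: "(quat, 'n) vec"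
    using blowup_param_in_affine_iff[of i b i] by (simp add: blowup_affine_def)
  have "subtopology blowup_topology blowup = (blowup_topology :: ((quat, 'n) vec \<times> _) topology)"
    by (metis subtopology_topspace topspace_blowup_topology)
  then have X: "quaternionic_regular_manifold (4 * CARD('n)) blowup_topology ?A"
    using blowup_manifold_subset[of blowup "\<lambda>_ :: 'n. UNIV" "4 * CARD('n)"] param
    by (simp add: coord_space_def)
  have E: "blowup_param i b \<in> exceptional_set \<longleftrightarrow> b \<in> coord_space (- {i})"
    for i and b :: "(quat, 'n) vec"
  proof -
    \<comment> \<open>Entry \<open>i\<close> of the representative is 1, so the point vanishes only
      if its scalar factor \<open>b $ i\<close> does.\<close>
    have "rscale (unit_coord i b) (b $ i) = 0 \<longleftrightarrow> b $ i = 0"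
      by (auto simp: vec_eq_iff unit_coord_nth)
    then show ?thesis
      by (auto simp: exceptional_set_def blowup_param_def qline_in_HP unit_coord_nonzero coord_space_def)
  qed
  have C: "coord_space (- {i}) = {b :: (quat, 'n) vec. b $ i = 0}" for i
    by (auto simp: coord_space_def)
  have "quaternionic_regular_manifold (4 * CARD('n) - 4) (subtopology blowup_topology exceptional_set)
      {(- {i}, exceptional_set \<inter> blowup_affine i, blowup_coord i) | i :: 'n. True}"
    using E exceptional_set_subset
    by (intro blowup_manifold_subset) (auto simp: Compl_eq_Diff_UNIV card_Diff_singleton diff_mult_distrib2)
  moreover have "{(- {i}, exceptional_set \<inter> blowup_affine i, blowup_coord i) | i :: 'n. True} =
      {(I - {i}, exceptional_set \<inter> V, \<phi>) | i I V \<phi>. (i, I, V, \<phi>) \<in> ?B}"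
  proof -
    have "exceptional_set \<inter> (blowup \<inter> blowup_affine i) = exceptional_set \<inter> blowup_affine i" for i :: 'n
      using exceptional_set_subset by blast
    then show ?thesis by (auto simp: Compl_eq_Diff_UNIV)
  qed
  moreover have "blowup_coord i ` (exceptional_set \<inter> (blowup \<inter> blowup_affine i)) =
      blowup_coord i ` (blowup \<inter> blowup_affine i) \<inter> {b. b $ i = 0}" for i :: 'n
  proof -
    have "blowup_coord i ` (blowup \<inter> blowup_affine i) = UNIV"
      by (rule blowup_coord_image) (simp add: param)
    moreover have "blowup_coord i ` (exceptional_set \<inter> blowup \<inter> blowup_affine i) = coord_space (- {i})"
      by (rule blowup_coord_image) (simp add: param E)
    ultimately show ?thesis by (simp add: C Int_assoc)
  qed
  \<comment> \<open>Subtraction of naturals is truncated; there is at least one coordinate, so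
    nothing is lost.\<close>
  moreover have "4 * CARD('n) - 4 + 4 = 4 * CARD('n)"
    using zero_less_card_finite[where 'a = 'n] by linarith
  ultimately have "quaternionic_submanifold (4 * CARD('n) - 4) blowup_topology ?A exceptional_set"
    using X exceptional_set_subset unfolding quaternionic_submanifold_def
    by (intro conjI exI[of _ ?B]) auto
  with X show ?thesis by blast
qed
end
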